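(* Let $(x_i,r_i)_{i\in\mathcal{I}}$ be a homogeneous ubiquitous system in a nonempty open set $U\subseteq\mathbb{R}^d$. Then for every real $t>1$, the set $F_t=\{x\in\mathbb{R}^d: |x-x_i|<r_i^t \text{ for infinitely many } i\}$ belongs to the large intersection class $G^{d/t}(U)$.
   Context: Fix a norm $|\cdot|$ on $\mathbb{R}^d$; $\mathcal{L}^d$ is Lebesgue measure. Let $\mathcal{I}$ be a countably infinite index set. A family $(x_i,r_i)_{i\in\mathcal{I}}$ in $\mathbb{R}^d\times(0,\infty)$ is an approximation system if $\sup_i r_i<\infty$ and for every $m\in\mathbb{N}$ the set $\{i: |x_i|<m,\ r_i>1/m\}$ is finite; it is a homogeneous ubiquitous system in a nonempty open set $U$ if moreover for $\mathcal{L}^d$-a.e. $x\in U$ there are infinitely many $i$ with $|x-x_i|<r_i$. Dyadic cubes are the sets $2^{-j}(k+[0,1)^d)$, $j\in\mathbb{Z}$, $k\in\mathbb{Z}^d$. For $t\in(0,d]$ and $E\subseteq\mathbb{R}^d$, $\mathcal{M}^t_\infty(E)=\inf\sum_n(\mathrm{diam}\,\lambda_n)^t$, the infimum over all countable coverings of $E$ by dyadic cubes $\lambda_n$ (of arbitrary size). For $s\in(0,d]$ and a nonempty open $U$, the class $G^s(U)$ consists of all $G_\delta$ subsets $F$ of $\mathbb{R}^d$ such that $\mathcal{M}^t_\infty(F\cap V)=\mathcal{M}^t_\infty(V)$ for every $t\in(0,s)$ and every open $V\subseteq U$. *)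

theory Defs
  imports "HOL-Analysis.Analysis"
begin

text \<open>A norm on a real vector space, given explicitly (the paper fixes an arbitrary norm).\<close>
definition is_norm :: "('a::real_vector \<Rightarrow> real) \<Rightarrow> bool" where
  "is_norm N \<longleftrightarrow> (\<forall>x. N x = 0 \<longleftrightarrow> x = 0) \<and> (\<forall>x y. N (x + y) \<le> N x + N y)
     \<and> (\<forall>c x. N (c *\<^sub>R x) = \<bar>c\<bar> * N x)"

definition approx_system ::
  "(real^'n \<Rightarrow> real) \<Rightarrow> 'i set \<Rightarrow> ('i \<Rightarrow> real^'n) \<Rightarrow> ('i \<Rightarrow> real) \<Rightarrow> bool" where
  "approx_system N I xs r \<longleftrightarrow> (\<forall>i\<in>I. r i > 0) \<and> bdd_above (r ` I)
     \<and> (\<forall>m::nat. finite {i\<in>I. N (xs i) < real m \<and> r i > 1 / real m})"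

definition hom_ubiquitous ::
  "(real^'n \<Rightarrow> real) \<Rightarrow> 'i set \<Rightarrow> ('i \<Rightarrow> real^'n) \<Rightarrow> ('i \<Rightarrow> real) \<Rightarrow> (real^'n) set \<Rightarrow> bool" where
  "hom_ubiquitous N I xs r U \<longleftrightarrow> approx_system N I xs r
     \<and> (AE x in lebesgue. x \<in> U \<longrightarrow> infinite {i\<in>I. N (x - xs i) < r i})"

definition dyadic_cubes :: "(real^'n) set set" where
  "dyadic_cubes = {Q. \<exists>(j::int) (k::'n \<Rightarrow> int).
      Q = {x. \<forall>b. (2 powr (- real_of_int j)) * real_of_int (k b) \<le> x $ b
                 \<and> x $ b < (2 powr (- real_of_int j)) * (real_of_int (k b) + 1)}}"

definition diamN :: "(real^'n \<Rightarrow> real) \<Rightarrow> (real^'n) set \<Rightarrow> real" where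
  "diamN N S = (SUP x\<in>S. SUP y\<in>S. N (x - y))"

definition net_content :: "(real^'n \<Rightarrow> real) \<Rightarrow> real \<Rightarrow> (real^'n) set \<Rightarrow> ennreal" where
  "net_content N t E = Inf {infsum (\<lambda>Q. ennreal (diamN N Q powr t)) C | C.
       countable C \<and> C \<subseteq> dyadic_cubes \<and> E \<subseteq> \<Union>C}"

definition large_int_class :: "(real^'n \<Rightarrow> real) \<Rightarrow> real \<Rightarrow> (real^'n) set \<Rightarrow> (real^'n) set set" where
  "large_int_class N s U = {F. gdelta_in euclidean F \<and>
      (\<forall>t V. 0 < t \<and> t < s \<and> open V \<and> V \<subseteq> U \<longrightarrow> net_content N t (F \<inter> V) = net_content N t V)}"

end

theory Submission
  imports Defs
begin

text \<open>
  Fix \<open>s < d / t\<close> and a family \<open>C\<close> of dyadic cubes. Call a dyadic cube good if no member of \<open>C\<close>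
  contains it and the members of \<open>C\<close> inside it have total cost \<open>\<Sum> side^s\<close> below its own. If an open
  set admits no dyadic cover as cheap as \<open>C\<close>, it contains a good cube: otherwise the maximal
  non-good cubes, together with the remaining members of \<open>C\<close>, would be such a cover.

  Inside a good cube \<open>L\<close> within \<open>U\<close> there is a good cube lying in one of the shrunken balls.
  First, giving extra weight to the small members of \<open>C\<close>, one may assume that all members of \<open>C\<close>
  inside \<open>L\<close> are much smaller than \<open>L\<close>. If for every ball of radius \<open>r\<close> the dyadic cube of side about
  \<open>r^t\<close> around its centre were not good, then the cube of side about \<open>r\<close> around the centre would be
  contained in a member of \<open>C\<close> or carry cost at least \<open>r^(s t)\<close>, far more than \<open>r^d\<close>. Dilations of the
  maximal such cubes cover almost all of \<open>L\<close> by ubiquity, which forces the cost of \<open>C\<close> in \<open>L\<close> above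
  \<open>(side L)^s\<close>.

  Iterating with nested closures, a cover \<open>C\<close> of the limsup set in \<open>V\<close> cheaper than every cover of \<open>V\<close>
  would leave a point of the limsup set uncovered.
\<close>

subsection \<open>Weighted sums over countable families\<close>

text \<open>Encoding the sum as a measure with density \<open>h\<close> makes monotonicity,
  additivity and continuity along monotone sequences of sets instances of measure theory, with no
  summability side conditions.\<close>

definition wsum :: "('b \<Rightarrow> ennreal) \<Rightarrow> 'b set \<Rightarrow> ennreal" where
  "wsum h X = emeasure (density (count_space UNIV) h) X"

lemma wsum_eq_nn_integral: "wsum h X = (\<integral>\<^sup>+Q. h Q * indicator X Q \<partial>count_space UNIV)"
  unfolding wsum_def by (subst emeasure_density) auto

lemma wsum_eq_nn_integral_count_space: "wsum h X = (\<integral>\<^sup>+Q. h Q \<partial>count_space X)"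
  unfolding wsum_eq_nn_integral by (simp add: nn_integral_count_space_indicator)

lemma wsum_mono_set: "X \<subseteq> Y \<Longrightarrow> wsum h X \<le> wsum h Y"
  unfolding wsum_def by (rule emeasure_mono) auto

lemma wsum_Un_le: "wsum h (X \<union> Y) \<le> wsum h X + wsum h Y"
  unfolding wsum_def by (rule emeasure_subadditive) auto

lemma wsum_Un_disjoint: "X \<inter> Y = {} \<Longrightarrow> wsum h (X \<union> Y) = wsum h X + wsum h Y"
  unfolding wsum_def by (rule plus_emeasure[symmetric]) auto

lemma wsum_le_cmult:
  assumes "\<And>Q. Q \<in> X \<Longrightarrow> h Q \<le> c * g Q"
  shows "wsum h X \<le> c * wsum g X"
proof -
  have "wsum h X \<le> (\<integral>\<^sup>+Q. c * g Q \<partial>count_space X)"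
    unfolding wsum_eq_nn_integral_count_space
    by (rule nn_integral_mono) (use assms in auto)
  also have "\<dots> = c * wsum g X"
    unfolding wsum_eq_nn_integral_count_space by (rule nn_integral_cmult) auto
  finally show ?thesis .
qed

lemma wsum_cmult: "wsum (\<lambda>Q. c * g Q) X = c * wsum g X"
  unfolding wsum_eq_nn_integral_count_space by (rule nn_integral_cmult) auto

lemma wsum_mono: "(\<And>Q. Q \<in> X \<Longrightarrow> h Q \<le> g Q) \<Longrightarrow> wsum h X \<le> wsum g X"
  using wsum_le_cmult[of X h 1 g] by simp

lemma wsum_ge_point: "Q \<in> X \<Longrightarrow> h Q \<le> wsum h X"
  unfolding wsum_eq_nn_integral_count_space by (rule nn_integral_ge_point)

lemma wsum_UN_disjoint:
  assumes "countable M" "disjoint_family_on X M"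
  shows "wsum h (\<Union>P\<in>M. X P) = wsum (\<lambda>P. wsum h (X P)) M"
  unfolding wsum_eq_nn_integral_count_space[of _ M] unfolding wsum_def
  by (rule emeasure_UN_countable) (use assms in auto)

text \<open>Both sides are limits of finite partial sums: a countable family is exhausted by the
  increasing finite sets \<open>A n\<close>, and continuity from below applies. This links
  \<open>wsum\<close> to the \<open>infsum\<close> in \<open>net_content\<close>.\<close>

lemma infsum_eq_wsum:
  fixes h :: "'b \<Rightarrow> ennreal"
  assumes "countable X"
  shows "infsum h X = wsum h X"
proof (rule antisym)
  have fin: "sum h F = wsum h F" if "finite F" for F
    unfolding wsum_eq_nn_integral_count_space using that by (simp add: nn_integral_count_space_finite)
  have inf: "infsum h X = (SUP F\<in>{F. finite F \<and> F \<subseteq> X}. sum h F)"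
    by (rule nonneg_infsum_complete) auto
  show "infsum h X \<le> wsum h X"
    unfolding inf by (rule SUP_least) (auto simp: fin intro: wsum_mono_set)
  show "wsum h X \<le> infsum h X"
  proof (cases "X = {}")
    case False
    define A where "A n = from_nat_into X ` {..<n}" for n
    have fA: "finite (A n)" "A n \<subseteq> X" for n
      unfolding A_def using False by (auto intro: from_nat_into)
    have "(\<Union>n. A n) = X"
      proof -
      have "(\<Union>n. A n) = from_nat_into X ` (\<Union>n. {..<n})" unfolding A_def by blast
      then show ?thesis using range_from_nat_into[OF False assms] by (simp add: UN_lessThan_UNIV)
    qed
    moreover have "incseq A" unfolding A_def by (auto simp: incseq_def)
    ultimately have "wsum h X = (SUP n. wsum h (A n))"
      unfolding wsum_def by (subst SUP_emeasure_incseq) auto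
    also have "\<dots> \<le> infsum h X"
      unfolding inf using fA by (intro SUP_least) (auto simp: fin[symmetric] intro!: SUP_upper)
    finally show ?thesis .
  qed (simp add: wsum_def)
qed

text \<open>Countable subadditivity, obtained by integrating an inequality of indicators and
  exchanging sum and integral. Only almost every point has to be covered, which is what ubiquity
  provides.\<close>

lemma emeasure_le_wsum_cover:
  assumes R: "countable R" and X: "X \<in> sets M"
    and H: "\<And>Q. Q \<in> R \<Longrightarrow> H Q \<in> sets M" "\<And>Q. Q \<in> R \<Longrightarrow> emeasure M (H Q) \<le> h Q"
    and cov: "AE x in M. x \<in> X \<longrightarrow> (\<exists>Q\<in>R. x \<in> H Q)"
  shows "emeasure M X \<le> wsum h R"
proof -
  have "emeasure M X = (\<integral>\<^sup>+x. indicator X x \<partial>M)" using X by simp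
  also have "\<dots> \<le> (\<integral>\<^sup>+x. (\<integral>\<^sup>+Q. indicator (H Q) x \<partial>count_space R) \<partial>M)"
  proof (rule nn_integral_mono_AE, use cov in eventually_elim)
    fix x assume *: "x \<in> X \<longrightarrow> (\<exists>Q\<in>R. x \<in> H Q)"
    show "indicator X x \<le> (\<integral>\<^sup>+Q. (indicator (H Q) x::ennreal) \<partial>count_space R)"
    proof (cases "x \<in> X")
      case True
      with * obtain Q where "Q \<in> R" "x \<in> H Q" by auto
      then show ?thesis using True nn_integral_ge_point[of Q R "\<lambda>Q. indicator (H Q) x"] by simp
    qed simp
  qed
  also have "\<dots> = (\<integral>\<^sup>+Q. (\<integral>\<^sup>+x. indicator (H Q) x \<partial>M) \<partial>count_space R)"
    by (rule nn_integral_count_space_nn_integral) (use R H in auto)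
  also have "\<dots> \<le> wsum h R"
    unfolding wsum_eq_nn_integral_count_space by (rule nn_integral_mono) (use H in auto)
  finally show ?thesis .
qed

text \<open>The sets \<open>A n\<close> decrease to the empty set because every
  \<open>\<sigma> Q\<close> is positive; as the total weight is finite, continuity from above
  applies.\<close>

lemma wsum_tail_small:
  fixes \<sigma> :: "'b \<Rightarrow> real"
  assumes fin: "wsum h C < \<infinity>" and pos: "\<And>Q. Q \<in> C \<Longrightarrow> \<sigma> Q > 0" and e: "e > 0"
  obtains \<delta> where "\<delta> > 0" "wsum h {Q\<in>C. \<sigma> Q < \<delta>} < e"
proof -
  define A where "A n = {Q\<in>C. \<sigma> Q < 1 / real (Suc n)}" for n
  have "decseq A"
    unfolding decseq_def
  proof (intro allI impI)
    fix m n :: nat assume "m \<le> n"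
    then have "1 / real (Suc n) \<le> 1 / real (Suc m)" by (simp add: frac_le)
    then show "A n \<subseteq> A m" by (auto simp: A_def)
  qed
  moreover have "(\<Inter>n. A n) = {}"
  proof (rule ccontr)
    assume "(\<Inter>n. A n) \<noteq> {}"
    then obtain Q where Q: "\<And>n. Q \<in> A n" by auto
    then have "\<sigma> Q > 0" using pos by (auto simp: A_def)
    then obtain n where "1 / real (Suc n) < \<sigma> Q"
      by (metis nat_approx_posE)
    with Q[of n] show False by (auto simp: A_def)
  qed
  moreover have "wsum h (A n) \<noteq> \<infinity>" for n
    using le_less_trans[OF wsum_mono_set[of "A n" C h] fin] by (auto simp: A_def)
  ultimately have "(\<lambda>n. wsum h (A n)) \<longlonglongrightarrow> 0"
    unfolding wsum_def using Lim_emeasure_decseq[of A "density (count_space UNIV) h"] by auto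
  then have "eventually (\<lambda>n. wsum h (A n) < e) sequentially"
    using e by (simp add: order_tendstoD)
  then obtain n where "wsum h (A n) < e" by (auto simp: eventually_sequentially)
  then show ?thesis by (intro that[of "1 / real (Suc n)"]) (auto simp: A_def)
qed

subsection \<open>Dyadic cubes\<close>

text \<open>The dyadic cube of generation \<open>j\<close> containing \<open>x\<close>. Indexing by
  a point instead of an integer vector makes all cubes through a common point comparable by
  \<open>j\<close> alone.\<close>

definition cell :: "int \<Rightarrow> real^'n \<Rightarrow> (real^'n) set" where
  "cell j x = {y. \<forall>b. \<lfloor>2 powr real_of_int j * y $ b\<rfloor> = \<lfloor>2 powr real_of_int j * x $ b\<rfloor>}"

text \<open>Recovered from the volume, since a cube given merely as a set carries no generation
  \<open>j\<close>.\<close>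

definition side :: "(real^'n) set \<Rightarrow> real" where
  "side Q = measure lborel Q powr (1 / real CARD('n))"

lemma mem_cell [simp]: "x \<in> cell j x"
  by (simp add: cell_def)

lemma cell_eqI: "y \<in> cell j x \<Longrightarrow> cell j y = cell j x"
  by (simp add: cell_def)

lemma cell_bounds:
  fixes y x :: "real^'n"
  shows "y \<in> cell j x \<longleftrightarrow>
   (\<forall>b. 2 powr (- real_of_int j) * real_of_int \<lfloor>2 powr real_of_int j * x $ b\<rfloor> \<le> y $ b
      \<and> y $ b < 2 powr (- real_of_int j) * (real_of_int \<lfloor>2 powr real_of_int j * x $ b\<rfloor> + 1))"
proof -
  have "\<lfloor>2 powr real_of_int j * y $ b\<rfloor> = k \<longleftrightarrow>
     2 powr (- real_of_int j) * real_of_int k \<le> y $ b \<and> y $ b < 2 powr (- real_of_int j) * (real_of_int k + 1)"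
    for b k
    by (simp add: floor_eq_iff powr_minus field_simps)
  then show ?thesis by (simp add: cell_def)
qed

lemma dyadic_cubes_eq: "dyadic_cubes = (\<Union>j. range (cell j))"
proof (intro set_eqI iffI)
  fix Q :: "(real^'n) set" assume "Q \<in> dyadic_cubes"
  then obtain j :: int and k :: "'n \<Rightarrow> int" where Q:
    "Q = {x. \<forall>b. (2 powr (- real_of_int j)) * real_of_int (k b) \<le> x $ b
                 \<and> x $ b < (2 powr (- real_of_int j)) * (real_of_int (k b) + 1)}"
    by (auto simp: dyadic_cubes_def)
  define x :: "real^'n" where "x = (\<chi> b. 2 powr (- real_of_int j) * real_of_int (k b))"
  have "\<lfloor>2 powr real_of_int j * x $ b\<rfloor> = k b" for b
    by (simp add: x_def mult.assoc[symmetric] powr_add[symmetric])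
  then have "Q = cell j x" unfolding Q by (auto simp: cell_bounds)
  then show "Q \<in> (\<Union>j. range (cell j))" by auto
next
  fix Q :: "(real^'n) set" assume "Q \<in> (\<Union>j. range (cell j))"
  then obtain j x where Q: "Q = cell j x" by auto
  show "Q \<in> dyadic_cubes"
    unfolding dyadic_cubes_def Q
    by (auto simp: cell_bounds set_eq_iff intro!: exI[of _ j] exI[of _ "\<lambda>b. \<lfloor>2 powr real_of_int j * x $ b\<rfloor>"])
qed

lemma cell_dyadic [simp]: "cell j x \<in> dyadic_cubes"
  by (auto simp: dyadic_cubes_eq)

lemma dyadic_cubesE:
  assumes "Q \<in> dyadic_cubes" obtains j x where "Q = cell j x"
  using assms by (auto simp: dyadic_cubes_eq)

lemma dyadic_cubes_cell:
  assumes "Q \<in> dyadic_cubes" "x \<in> Q" obtains j where "Q = cell j x"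
  using assms by (metis dyadic_cubesE cell_eqI)

lemma countable_dyadic_cubes: "countable (dyadic_cubes :: (real^'n) set set)"
proof -
  have "(dyadic_cubes :: (real^'n) set set) \<subseteq>
     (\<lambda>(j, k). {y. \<forall>b. \<lfloor>2 powr real_of_int j * y $ b\<rfloor> = k b}) ` (UNIV \<times> (UNIV :: ('n \<Rightarrow> int) set))"
    by (auto simp: dyadic_cubes_eq cell_def image_iff)
  moreover have "countable (UNIV :: ('n \<Rightarrow> int) set)" by simp
  ultimately show ?thesis by (meson countable_SIGMA countable_image countable_subset countableI_type)
qed

lemma cell_mono:
  assumes "j \<le> j'" shows "cell j' x \<subseteq> cell j x"
proof
  fix y assume y: "y \<in> cell j' x"
  define n where "n = nat (j' - j)"
  have n: "real_of_int j = real_of_int j' - real n" using assms by (simp add: n_def)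
  \<comment> \<open>Refining by \<open>n\<close> generations multiplies coordinates by
    \<open>2 ^ n\<close>, so the coarse integer part is an integer quotient of the fine one.\<close>
  have "\<lfloor>2 powr real_of_int j * z\<rfloor> = \<lfloor>2 powr real_of_int j' * z\<rfloor> div 2 ^ n" for z :: real
    using floor_divide_real_eq_div[of "2 ^ n" "2 powr real_of_int j' * z"]
    by (simp add: n powr_diff powr_realpow)
  with y show "y \<in> cell j x" by (simp add: cell_def)
qed

section \<open>Volumes and side lengths of cubes\<close>

definition low_corner :: "int \<Rightarrow> real^'n \<Rightarrow> real^'n" where
  "low_corner j x = (\<chi> b. 2 powr (- real_of_int j) * real_of_int \<lfloor>2 powr real_of_int j * x $ b\<rfloor>)"

lemma cell_low_corner: "y \<in> cell j x \<longleftrightarrow> (\<forall>b. low_corner j x $ b \<le> y $ b \<and> y $ b < low_corner j x $ b + 2 powr (- real_of_int j))"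
  unfolding cell_bounds low_corner_def by (simp add: algebra_simps)

lemma box_subset_cell: "box (low_corner j x) (low_corner j x + (\<chi> b. 2 powr (- real_of_int j))) \<subseteq> cell j x"
  by (auto simp: cell_low_corner mem_box_cart less_imp_le)

lemma cell_subset_cbox: "cell j x \<subseteq> cbox (low_corner j x) (low_corner j x + (\<chi> b. 2 powr (- real_of_int j)))"
  by (auto simp: cell_low_corner mem_box_cart less_imp_le)

lemma emeasure_cube_box:
  fixes a :: "real^'n" assumes "0 \<le> h"
  shows "emeasure lborel (box a (a + (\<chi> b. h))) = ennreal (h ^ CARD('n))"
    and "emeasure lborel (cbox a (a + (\<chi> b. h))) = ennreal (h ^ CARD('n))"
proof -
  have "(\<Prod>b\<in>(Basis::(real^'n) set). (\<chi> b. h) \<bullet> b) = h ^ CARD('n)"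
  proof -
    have "(\<Prod>b\<in>(Basis::(real^'n) set). (\<chi> b. h) \<bullet> b) = (\<Prod>b\<in>(Basis::(real^'n) set). h)"
      by (rule prod.cong) (auto simp: Basis_vec_def inner_axis)
    then show ?thesis by simp
  qed
  moreover have "a \<bullet> b \<le> (a + (\<chi> b. h)) \<bullet> b" if "b \<in> Basis" for b
    using that assms by (auto simp: Basis_vec_def inner_axis)
  ultimately show "emeasure lborel (box a (a + (\<chi> b. h))) = ennreal (h ^ CARD('n))"
    and "emeasure lborel (cbox a (a + (\<chi> b. h))) = ennreal (h ^ CARD('n))"
    by (simp_all add: emeasure_lborel_cbox_eq)
qed

lemma cell_borel [measurable]: "cell j x \<in> sets borel"
proof -
  have "cell j x = (\<Inter>b. {y. low_corner j x $ b \<le> y $ b} \<inter> {y. y $ b < low_corner j x $ b + 2 powr (- real_of_int j)})"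
    by (auto simp: cell_low_corner)
  also have "\<dots> \<in> sets borel"
    by (intro sets.countable_INT' sets.Int) auto
  finally show ?thesis .
qed

lemma emeasure_cell:
  fixes x :: "real^'n"
  shows "emeasure lborel (cell j x) = ennreal ((2 powr (- real_of_int j)) ^ CARD('n))"
proof (rule antisym)
  show "emeasure lborel (cell j x) \<le> ennreal ((2 powr (- real_of_int j)) ^ CARD('n))"
    using emeasure_mono[OF cell_subset_cbox[of j x], of lborel] emeasure_cube_box(2)[of "2 powr (- real_of_int j)" "low_corner j x"]
    by simp
  show "ennreal ((2 powr (- real_of_int j)) ^ CARD('n)) \<le> emeasure lborel (cell j x)"
    using emeasure_mono[OF box_subset_cell[of j x], of lborel] emeasure_cube_box(1)[of "2 powr (- real_of_int j)" "low_corner j x"]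
    by simp
qed

lemma side_cell [simp]: "side (cell j x) = 2 powr (- real_of_int j)"
proof -
  have "measure lborel (cell j x) = (2 powr (- real_of_int j)) powr (real CARD('a))"
    by (simp add: measure_def emeasure_cell powr_realpow)
  then show ?thesis by (simp add: side_def powr_powr)
qed

lemma side_pos [simp]: "Q \<in> dyadic_cubes \<Longrightarrow> side Q > 0"
  by (auto elim!: dyadic_cubesE)

lemma emeasure_dyadic:
  fixes Q :: "(real^'n) set"
  assumes "Q \<in> dyadic_cubes"
  shows "emeasure lborel Q = ennreal (side Q powr real CARD('n))"
  using assms by (auto elim!: dyadic_cubesE simp: emeasure_cell powr_realpow)

lemma dyadic_borel: "Q \<in> dyadic_cubes \<Longrightarrow> Q \<in> sets borel"
  by (auto elim!: dyadic_cubesE)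

lemma dyadic_nonempty: "Q \<in> dyadic_cubes \<Longrightarrow> Q \<noteq> {}"
  by (auto elim!: dyadic_cubesE) (metis empty_iff mem_cell)

text \<open>An open box in the cube already has its full volume, so volume arguments survive the
  passage to the interior where an open set is required.\<close>

lemma interior_dyadic:
  fixes Q :: "(real^'n) set"
  assumes "Q \<in> dyadic_cubes"
  shows "emeasure lborel (interior Q) = ennreal (side Q powr real CARD('n))"
proof -
  from assms obtain j x where Q: "Q = cell j x" by (rule dyadic_cubesE)
  have sub: "box (low_corner j x) (low_corner j x + (\<chi> b. 2 powr (- real_of_int j))) \<subseteq> interior Q"
    unfolding Q by (intro interior_maximal box_subset_cell open_box)
  show "emeasure lborel (interior Q) = ennreal (side Q powr real CARD('n))"
  proof (rule antisym)
    show "emeasure lborel (interior Q) \<le> ennreal (side Q powr real CARD('n))"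
      unfolding emeasure_dyadic[OF assms, symmetric]
      by (rule emeasure_mono) (use interior_subset dyadic_borel[OF assms] in auto)
    show "ennreal (side Q powr real CARD('n)) \<le> emeasure lborel (interior Q)"
      using emeasure_mono[OF sub, of lborel] emeasure_cube_box(1)[of "2 powr (- real_of_int j)" "low_corner j x"]
      by (simp add: Q powr_realpow)
  qed
qed

section \<open>Nesting, scales and maximal cubes\<close>

lemma side_mono:
  fixes Q :: "(real^'n) set"
  assumes "Q \<in> dyadic_cubes" "Q' \<in> dyadic_cubes" "Q \<subseteq> Q'" shows "side Q \<le> side Q'"
proof -
  have "emeasure lborel Q \<le> emeasure lborel Q'"
    by (rule emeasure_mono) (use assms dyadic_borel in auto)
  then have "side Q powr real CARD('n) \<le> side Q' powr real CARD('n)"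
    by (simp add: emeasure_dyadic assms)
  then show ?thesis
    using powr_less_mono2[of "real CARD('n)" "side Q'" "side Q"] side_pos[OF assms(2)]
    by (metis linorder_not_le less_imp_le of_nat_0_less_iff zero_less_card_finite)
qed

lemma dyadic_nested:
  assumes "Q \<in> dyadic_cubes" "Q' \<in> dyadic_cubes" "x \<in> Q" "x \<in> Q'" "side Q \<le> side Q'"
  shows "Q \<subseteq> Q'"
proof -
  obtain j j' where "Q = cell j x" "Q' = cell j' x"
    using assms by (metis dyadic_cubes_cell)
  with assms(5) show ?thesis using cell_mono[of j' j x] by simp
qed

lemma dyadic_cases:
  assumes "Q \<in> dyadic_cubes" "Q' \<in> dyadic_cubes" "Q \<inter> Q' \<noteq> {}"
  shows "Q \<subseteq> Q' \<or> Q' \<subseteq> Q"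
  using assms dyadic_nested[of Q Q'] dyadic_nested[of Q' Q] by (meson disjoint_iff linorder_le_cases)

text \<open>Stated for closures because the limit point is found in an intersection of closed cubes,
  and these closures must lie in the balls.\<close>

lemma closure_dyadic_component:
  fixes Q :: "(real^'n) set"
  assumes "Q \<in> dyadic_cubes" "x \<in> closure Q" "y \<in> closure Q"
  shows "\<bar>x $ b - y $ b\<bar> \<le> side Q"
proof -
  from assms obtain j z where Q: "Q = cell j z" by (metis dyadic_cubesE)
  have "closure Q \<subseteq> cbox (low_corner j z) (low_corner j z + (\<chi> b. 2 powr (- real_of_int j)))"
    unfolding Q by (intro closure_minimal cell_subset_cbox closed_cbox)
  with assms have "low_corner j z $ b \<le> x $ b \<and> x $ b \<le> low_corner j z $ b + side Q"
     "low_corner j z $ b \<le> y $ b \<and> y $ b \<le> low_corner j z $ b + side Q"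
    by (auto simp: subset_iff mem_box_cart Q)
  then show ?thesis by auto
qed

lemma dyadic_scale_exists:
  assumes "0 < r"
  obtains j where "2 powr (- real_of_int j) \<le> r" "r < 2 * 2 powr (- real_of_int j)"
proof -
  have r: "r = 2 powr (log 2 r)" using assms by simp
  have "2 powr real_of_int \<lfloor>log 2 r\<rfloor> \<le> r"
    by (subst r, intro powr_mono) auto
  moreover have "2 powr (log 2 r) < 2 powr (1 + real_of_int \<lfloor>log 2 r\<rfloor>)"
    by (intro powr_less_mono) linarith+
  ultimately show ?thesis
    using r by (intro that[of "- \<lfloor>log 2 r\<rfloor>"]) (simp_all add: powr_add)
qed

text \<open>Bounded sides bound the generation from below, so among the cubes of \<open>B\<close>
  through a fixed point there is a largest one. Nestedness makes distinct maximal cubes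
  disjoint.\<close>

lemma dyadic_maximal:
  fixes B :: "(real^'n) set set"
  assumes B: "B \<subseteq> dyadic_cubes" and bd: "\<And>Q. Q \<in> B \<Longrightarrow> side Q \<le> \<delta>"
  obtains M where "M \<subseteq> B" "pairwise disjnt M" "\<And>Q. Q \<in> B \<Longrightarrow> \<exists>P\<in>M. Q \<subseteq> P"
proof -
  define M where "M = {P\<in>B. \<forall>Q\<in>B. P \<subseteq> Q \<longrightarrow> Q = P}"
  show ?thesis
  proof (rule that[of M])
    show "M \<subseteq> B" by (auto simp: M_def)
    show "pairwise disjnt M"
    proof (rule pairwiseI)
      fix P P' assume "P \<in> M" "P' \<in> M" "P \<noteq> P'"
      then show "disjnt P P'"
        using dyadic_cases[of P P'] B by (auto simp: M_def disjnt_def)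
    qed
    fix Q assume Q: "Q \<in> B"
    with B have "Q \<noteq> {}" by (auto dest: dyadic_nonempty)
    then obtain x where x: "x \<in> Q" by auto
    define S where "S = {j. cell j x \<in> B}"
    from Q B x obtain j0 where j0: "Q = cell j0 x" by (metis dyadic_cubes_cell subsetD)
    have bdd: "- log 2 \<delta> \<le> real_of_int j" if "j \<in> S" for j
    proof -
      have le: "2 powr (- real_of_int j) \<le> \<delta>" using bd[of "cell j x"] that by (simp add: S_def)
      have "0 < 2 powr (- real_of_int j)" by simp
      then have "0 < \<delta>" using le by linarith
      with le have "- real_of_int j \<le> log 2 \<delta>" by (simp add: le_log_iff)
      then show ?thesis by simp
    qed
    have "j0 \<in> S" using Q j0 by (simp add: S_def)
    obtain j where j: "j \<in> S" "\<And>i. i \<in> S \<Longrightarrow> j \<le> i"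
    proof -
      define L where "L = \<lfloor>- log 2 \<delta>\<rfloor>"
      have L: "L \<le> i" if "i \<in> S" for i using bdd[OF that] by (simp add: L_def) linarith
      \<comment> \<open>The minimum is taken over natural offsets from the lower bound
        \<open>L\<close>, since the integers are not well-ordered.\<close>
      define m where "m = (LEAST n. L + int n \<in> S)"
      have "L + int (nat (j0 - L)) \<in> S" using \<open>j0 \<in> S\<close> L[of j0] by simp
      then have "L + int m \<in> S" unfolding m_def by (rule LeastI)
      moreover have "L + int m \<le> i" if "i \<in> S" for i
      proof -
        have "m \<le> nat (i - L)" unfolding m_def by (rule Least_le) (use that L[of i] in simp)
        then show ?thesis using L[OF that] by linarith
      qed
      ultimately show ?thesis using that by blast
    qed
    have "cell j x \<in> M"
      unfolding M_def
    proof (intro CollectI conjI ballI impI)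
      show "cell j x \<in> B" using j by (simp add: S_def)
      fix R assume R: "R \<in> B" "cell j x \<subseteq> R"
      then have "x \<in> R" using mem_cell by blast
      then obtain i where i: "R = cell i x" using R B by (metis dyadic_cubes_cell subsetD)
      then have "j \<le> i" using R j by (auto simp: S_def)
      then show "R = cell j x" using cell_mono[of j i x] R i by auto
    qed
    moreover have "Q \<subseteq> cell j x" unfolding j0 using j \<open>j0 \<in> S\<close> by (intro cell_mono) auto
    ultimately show "\<exists>P\<in>M. Q \<subseteq> P" by auto
  qed
qed

subsection \<open>Covering costs and stopping cubes\<close>

abbreviation cost :: "real \<Rightarrow> (real^'n) set set \<Rightarrow> ennreal" where
  "cost s X \<equiv> wsum (\<lambda>Q. ennreal (side Q powr s)) X"

text \<open>The first clause leaves the limit point uncovered in the end; the cost bound lets the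
  choice of a cube be repeated inside \<open>P\<close>.\<close>

definition good :: "real \<Rightarrow> (real^'n) set set \<Rightarrow> (real^'n) set \<Rightarrow> bool" where
  "good s C P \<longleftrightarrow> (\<forall>Q\<in>C. \<not> P \<subseteq> Q) \<and> cost s (C \<inter> Pow P) < ennreal (side P powr s)"

lemma wsum_restrict: "wsum (\<lambda>Q. f Q * indicator C Q) X = wsum f (X \<inter> C)"
  unfolding wsum_eq_nn_integral by (simp add: indicator_inter_arith mult.assoc mult.commute mult.left_commute)

lemma wsum_add: "wsum (\<lambda>Q. f Q + g Q) X = wsum f X + wsum g X"
  unfolding wsum_eq_nn_integral_count_space by (rule nn_integral_add) auto

lemma small_dyadic_inside_open:
  fixes x :: "real^'n"
  assumes "open W" "x \<in> W" "0 < \<delta>"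
  obtains P where "P \<in> dyadic_cubes" "x \<in> P" "closure P \<subseteq> W" "side P \<le> \<delta>"
proof -
  obtain e where e: "e > 0" "ball x e \<subseteq> W" using assms by (meson openE)
  \<comment> \<open>With side at most \<open>e\<close> over twice the dimension, the l1 bound keeps
    points of the closed cube within \<open>e / 2\<close> of \<open>x\<close>.\<close>
  define \<rho> where "\<rho> = min \<delta> (e / (2 * real CARD('n)))"
  have "\<rho> > 0" using e assms by (simp add: \<rho>_def)
  then obtain j where j: "2 powr (- real_of_int j) \<le> \<rho>" by (rule dyadic_scale_exists)
  have "closure (cell j x) \<subseteq> W"
  proof
    fix y assume y: "y \<in> closure (cell j x)"
    have "norm (x - y) \<le> (\<Sum>b\<in>UNIV. \<bar>(x - y) $ b\<bar>)" by (rule norm_le_l1_cart)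
    also have "\<dots> \<le> (\<Sum>b\<in>(UNIV::'n set). \<rho>)"
      using closure_dyadic_component[OF cell_dyadic closure_subset[THEN subsetD, OF mem_cell] y] j
      by (intro sum_mono) (auto intro: order_trans)
    also have "\<dots> = real CARD('n) * \<rho>" by simp
    also have "\<dots> \<le> real CARD('n) * (e / (2 * real CARD('n)))"
      by (rule mult_left_mono) (auto simp: \<rho>_def)
    also have "\<dots> < e" using e by simp
    finally show "y \<in> W" using e by (auto simp: dist_norm)
  qed
  then show ?thesis using j by (intro that[of "cell j x"]) (auto simp: \<rho>_def)
qed

text \<open>A common subcube of two disjoint cubes would be empty, and dyadic cubes are not. Hence
  weights inside the members of \<open>M\<close> add up without double counting.\<close>

lemma disjoint_family_subcubes:
  assumes M: "pairwise disjnt M" and C: "C \<subseteq> dyadic_cubes"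
  shows "disjoint_family_on (\<lambda>P. C \<inter> Pow P) M"
  unfolding disjoint_family_on_def
proof (intro ballI impI)
  fix P P' assume "P \<in> M" "P' \<in> M" "P \<noteq> P'"
  with M have "P \<inter> P' = {}" by (auto simp: pairwise_def disjnt_def)
  then have "Q = {}" if "Q \<subseteq> P" "Q \<subseteq> P'" for Q using that by blast
  then show "(C \<inter> Pow P) \<inter> (C \<inter> Pow P') = {}" using C dyadic_nonempty by blast
qed

text \<open>If every small cube failed, maximal heavy cubes could replace everything inside them
  without raising the total. A general weight \<open>h\<close> above the cost on \<open>C\<close> is
  allowed so that small members can later be penalized.\<close>

lemma stopping_cube:
  fixes C :: "(real^'n) set set"
  assumes W: "open W" and C: "C \<subseteq> dyadic_cubes" and \<delta>: "0 < \<delta>"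
    and h: "\<And>Q. Q \<in> C \<Longrightarrow> ennreal (side Q powr s) \<le> h Q"
    and lt: "\<And>C'. C' \<subseteq> dyadic_cubes \<Longrightarrow> W \<subseteq> \<Union>C' \<Longrightarrow> wsum h dyadic_cubes < cost s C'"
  obtains P where "P \<in> dyadic_cubes" "closure P \<subseteq> W" "side P \<le> \<delta>" "\<And>Q. Q \<in> C \<Longrightarrow> \<not> P \<subseteq> Q"
    "wsum h (dyadic_cubes \<inter> Pow P) < ennreal (side P powr s)"
proof (rule ccontr)
  assume no: "\<not> thesis"
  note witness = that
  have bad: "(\<exists>Q\<in>C. P \<subseteq> Q) \<or> ennreal (side P powr s) \<le> wsum h (dyadic_cubes \<inter> Pow P)"
    if *: "P \<in> dyadic_cubes" "closure P \<subseteq> W" "side P \<le> \<delta>" for P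
  proof (rule ccontr)
    assume "\<not> ((\<exists>Q\<in>C. P \<subseteq> Q) \<or> ennreal (side P powr s) \<le> wsum h (dyadic_cubes \<inter> Pow P))"
    then have "thesis" by (intro witness[of P] *) auto
    with no show False ..
  qed
  define B where "B = {P\<in>dyadic_cubes. side P \<le> \<delta> \<and> ennreal (side P powr s) \<le> wsum h (dyadic_cubes \<inter> Pow P)}"
  obtain M where M: "M \<subseteq> B" "pairwise disjnt M" "\<And>Q. Q \<in> B \<Longrightarrow> \<exists>P\<in>M. Q \<subseteq> P"
    by (rule dyadic_maximal[of B \<delta>]) (auto simp: B_def)
  have Md: "M \<subseteq> dyadic_cubes" using M(1) by (auto simp: B_def)
  \<comment> \<open>Members of \<open>C\<close> inside a maximal heavy cube are dropped; the weight
    inside such a cube pays for it.\<close>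
  define D where "D = {Q\<in>C. \<forall>P\<in>M. \<not> Q \<subseteq> P}"
  have "W \<subseteq> \<Union>(D \<union> M)"
  proof
    fix x assume "x \<in> W"
    then obtain P where P: "P \<in> dyadic_cubes" "x \<in> P" "closure P \<subseteq> W" "side P \<le> \<delta>"
      by (rule small_dyadic_inside_open[OF W _ \<delta>])
    from bad[OF P(1,3,4)] show "x \<in> \<Union>(D \<union> M)"
    proof
      assume "\<exists>Q\<in>C. P \<subseteq> Q"
      then show ?thesis using P(2) by (auto simp: D_def)
    next
      assume "ennreal (side P powr s) \<le> wsum h (dyadic_cubes \<inter> Pow P)"
      with P have "P \<in> B" by (simp add: B_def)
      with M(3) P(2) show ?thesis by blast
    qed
  qed
  moreover have "D \<union> M \<subseteq> dyadic_cubes" using C Md by (auto simp: D_def)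
  ultimately have "wsum h dyadic_cubes < cost s (D \<union> M)" by (intro lt)
  also have "\<dots> \<le> cost s D + cost s M" by (rule wsum_Un_le)
  also have "cost s D \<le> wsum h D" by (rule wsum_mono) (auto simp: D_def h)
  also have "cost s M \<le> wsum (\<lambda>P. wsum h (dyadic_cubes \<inter> Pow P)) M"
    by (rule wsum_mono) (use M(1) in \<open>auto simp: B_def\<close>)
  also have "\<dots> = wsum h (\<Union>P\<in>M. dyadic_cubes \<inter> Pow P)"
  proof (rule wsum_UN_disjoint[symmetric])
    show "countable M" using Md countable_dyadic_cubes countable_subset by blast
    show "disjoint_family_on (\<lambda>P. dyadic_cubes \<inter> Pow P) M"
      by (rule disjoint_family_subcubes[OF M(2) order_refl])
  qed
  \<comment> \<open>No member of \<open>D\<close> lies inside a cube of \<open>M\<close>, so the two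
    families are disjoint and each weight is counted at most once.\<close>
  also have "wsum h D + wsum h (\<Union>P\<in>M. dyadic_cubes \<inter> Pow P) = wsum h (D \<union> (\<Union>P\<in>M. dyadic_cubes \<inter> Pow P))"
    by (rule wsum_Un_disjoint[symmetric]) (auto simp: D_def)
  also have "\<dots> \<le> wsum h dyadic_cubes"
    by (rule wsum_mono_set) (use C in \<open>auto simp: D_def\<close>)
  finally show False by (simp add: add_left_mono add_right_mono)
qed

text \<open>Splits off the factor \<open>side Q powr (d - s)\<close>: small cubes have small volume
  relative to their cost.\<close>

lemma cost_powr_le:
  fixes C :: "(real^'n) set set"
  assumes C: "C \<subseteq> dyadic_cubes" and le: "\<And>Q. Q \<in> C \<Longrightarrow> side Q \<le> \<sigma>" and sd: "s \<le> d"
  shows "cost d C \<le> ennreal (\<sigma> powr (d - s)) * cost s C"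
proof (rule wsum_le_cmult)
  fix Q assume Q: "Q \<in> C"
  then have pos: "0 < side Q" using C by auto
  have "side Q powr d = side Q powr (d - s) * side Q powr s" by (simp add: powr_add[symmetric])
  also have "\<dots> \<le> \<sigma> powr (d - s) * side Q powr s"
    using pos le[OF Q] sd by (intro mult_right_mono powr_mono2) auto
  finally show "ennreal (side Q powr d) \<le> ennreal (\<sigma> powr (d - s)) * ennreal (side Q powr s)"
    by (simp add: ennreal_mult[symmetric] ennreal_leI)
qed

text \<open>A member containing \<open>L\<close> suffices by itself. Otherwise the members meeting
  the interior lie in \<open>L\<close>, their volumes sum to at least that of \<open>L\<close>, and
  \<open>cost_powr_le\<close> turns this into a bound at exponent \<open>s\<close>.\<close>

lemma interior_cost_ge:
  fixes L :: "(real^'n) set"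
  assumes L: "L \<in> dyadic_cubes" and C: "C \<subseteq> dyadic_cubes" "interior L \<subseteq> \<Union>C"
    and s: "0 < s" "s \<le> real CARD('n)"
  shows "ennreal (side L powr s) \<le> cost s C"
proof (cases "\<exists>Q\<in>C. L \<subseteq> Q")
  case True
  then obtain Q where Q: "Q \<in> C" "L \<subseteq> Q" by auto
  then have "side L \<le> side Q" using L C by (auto intro: side_mono)
  then have "ennreal (side L powr s) \<le> ennreal (side Q powr s)"
    using side_pos[OF L] s by (intro ennreal_leI powr_mono2) auto
  also have "\<dots> \<le> cost s C" using Q(1) by (rule wsum_ge_point)
  finally show ?thesis .
next
  case False
  define D where "D = C \<inter> Pow L"
  have cov: "interior L \<subseteq> \<Union>D"
  proof
    fix x assume x: "x \<in> interior L"
    with C obtain Q where Q: "Q \<in> C" "x \<in> Q" by auto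
    then have "Q \<subseteq> L" using False C(1) L x interior_subset[of L] dyadic_cases[of Q L] by blast
    with Q show "x \<in> \<Union>D" by (auto simp: D_def)
  qed
  have Dd: "D \<subseteq> dyadic_cubes" using C by (auto simp: D_def)
  have "ennreal (side L powr real CARD('n)) = emeasure lborel (interior L)"
    using interior_dyadic[OF L] by simp
  also have "\<dots> \<le> cost (real CARD('n)) D"
  proof (rule emeasure_le_wsum_cover[where H = "\<lambda>Q. Q"])
    show "countable D" using Dd countable_dyadic_cubes countable_subset by blast
    show "AE x in lborel. x \<in> interior L \<longrightarrow> (\<exists>Q\<in>D. x \<in> Q)" using cov by (intro AE_I2) auto
  qed (use Dd in \<open>auto simp: subset_iff dyadic_borel emeasure_dyadic\<close>)
  also have "\<dots> \<le> ennreal (side L powr (real CARD('n) - s)) * cost s D"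
    by (rule cost_powr_le) (use Dd L s in \<open>auto simp: D_def intro: side_mono\<close>)
  finally have *: "ennreal (side L powr real CARD('n)) \<le> ennreal (side L powr (real CARD('n) - s)) * cost s D" .
  have "ennreal (side L powr s) \<le> cost s D"
  proof (cases "cost s D")
    case (real w)
    with * have "side L powr real CARD('n) \<le> side L powr (real CARD('n) - s) * w"
      by (simp add: ennreal_mult[symmetric])
    moreover have "side L powr real CARD('n) = side L powr (real CARD('n) - s) * side L powr s"
      by (simp add: powr_add[symmetric])
    ultimately have "side L powr s \<le> w" using side_pos[OF L] by simp
    with real show ?thesis by (simp add: ennreal_leI)
  qed simp
  also have "\<dots> \<le> cost s C" by (rule wsum_mono_set) (auto simp: D_def)
  finally show ?thesis .
qed

text \<open>Every \<open>Q\<close> is replaced by an axis-parallel box around a chosen point of it,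
  whose volume is a fixed multiple of that of \<open>Q\<close>.\<close>

lemma side_le_enlarged_cover:
  fixes L :: "(real^'n) set"
  assumes L: "L \<in> dyadic_cubes" and R: "R \<subseteq> dyadic_cubes" and a: "0 \<le> a"
    and cov: "AE x in lborel. x \<in> interior L \<longrightarrow> (\<exists>Q\<in>R. \<exists>z\<in>Q. \<forall>b. \<bar>x $ b - z $ b\<bar> \<le> a * side Q)"
  shows "ennreal (side L powr real CARD('n)) \<le> ennreal ((2 * (a + 1)) ^ CARD('n)) * cost (real CARD('n)) R"
proof -
  define c where "c Q = (SOME z. z \<in> Q)" for Q :: "(real^'n) set"
  have c: "c Q \<in> Q" if "Q \<in> R" for Q
    unfolding c_def using that R dyadic_nonempty by (metis some_in_eq subsetD)
  \<comment> \<open>The half-width allows \<open>a\<close> side lengths from the covered point to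
    \<open>z\<close>, plus one from \<open>z\<close> to the chosen point \<open>c Q\<close>.\<close>
  define l where "l Q = c Q - (\<chi> b. (a + 1) * side Q)" for Q :: "(real^'n) set"
  define H where "H Q = cbox (l Q) (l Q + (\<chi> b. 2 * (a + 1) * side Q))" for Q :: "(real^'n) set"
  have "ennreal (side L powr real CARD('n)) = emeasure lborel (interior L)"
    using interior_dyadic[OF L] by simp
  also have "\<dots> \<le> wsum (\<lambda>Q. ennreal ((2 * (a + 1)) ^ CARD('n)) * ennreal (side Q powr real CARD('n))) R"
  proof (rule emeasure_le_wsum_cover[where H = H])
    show "countable R" using R countable_dyadic_cubes countable_subset by blast
    show "AE x in lborel. x \<in> interior L \<longrightarrow> (\<exists>Q\<in>R. x \<in> H Q)"
    proof (use cov in eventually_elim, intro impI)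
      fix x assume "x \<in> interior L \<longrightarrow> (\<exists>Q\<in>R. \<exists>z\<in>Q. \<forall>b. \<bar>x $ b - z $ b\<bar> \<le> a * side Q)" "x \<in> interior L"
      then obtain Q z where Q: "Q \<in> R" "z \<in> Q" "\<And>b. \<bar>x $ b - z $ b\<bar> \<le> a * side Q" by auto
      have zc: "\<bar>z $ b - c Q $ b\<bar> \<le> side Q" for b
        using R Q c closure_subset[of Q] by (intro closure_dyadic_component) (auto simp: subset_iff)
      have "\<bar>x $ b - c Q $ b\<bar> \<le> a * side Q + side Q" for b
        using Q(3)[of b] zc[of b] by linarith
      then have "x \<in> H Q"
        unfolding H_def l_def mem_box_cart by (auto simp: abs_le_iff algebra_simps)
      with Q show "\<exists>Q\<in>R. x \<in> H Q" by auto
    qed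
    fix Q assume "Q \<in> R"
    then have pos: "0 < side Q" using R by auto
    show "H Q \<in> sets lborel" by (simp add: H_def)
    have "emeasure lborel (H Q) = ennreal ((2 * (a + 1) * side Q) ^ CARD('n))"
      unfolding H_def by (rule emeasure_cube_box) (use pos a in auto)
    then show "emeasure lborel (H Q) \<le> ennreal ((2 * (a + 1)) ^ CARD('n)) * ennreal (side Q powr real CARD('n))"
      using pos a by (simp add: ennreal_mult[symmetric] power_mult_distrib powr_realpow)
  qed simp
  also have "\<dots> = ennreal ((2 * (a + 1)) ^ CARD('n)) * cost (real CARD('n)) R" by (rule wsum_cmult)
  finally show ?thesis .
qed

subsection \<open>Norms and diameters\<close>

lemma is_norm_zero: "is_norm N \<Longrightarrow> N 0 = 0"
  unfolding is_norm_def by blast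

lemma is_norm_minus: "is_norm N \<Longrightarrow> N (- x) = N x"
  unfolding is_norm_def by (metis abs_1 abs_minus_cancel lambda_one mult_1 scaleR_minus1_left)

lemma is_norm_nonneg: assumes "is_norm N" shows "0 \<le> N x"
proof -
  have "N (x + - x) \<le> N x + N (- x)" "N (0::'a) = 0" using assms unfolding is_norm_def by blast+
  with is_norm_minus[OF assms, of x] show ?thesis by simp
qed

lemma is_norm_component_upper:
  fixes N :: "real^'n \<Rightarrow> real"
  assumes N: "is_norm N"
  obtains c where "c > 0" "\<And>x B. (\<And>b. \<bar>x $ b\<bar> \<le> B) \<Longrightarrow> N x \<le> c * B"
proof -
  define c where "c = (\<Sum>b\<in>UNIV. N (axis b 1))"
  have sum_le: "N (\<Sum>b\<in>S. f b) \<le> (\<Sum>b\<in>S. N (f b))" if "finite S" for S :: "'n set" and f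
    using that
  proof (induction S)
    case (insert b S)
    have "N (f b + sum f S) \<le> N (f b) + N (sum f S)" using N unfolding is_norm_def by blast
    with insert show ?case by simp
  qed (simp add: is_norm_zero[OF N])
  have le: "N x \<le> c * B" if "\<And>b. \<bar>x $ b\<bar> \<le> B" for x B
  proof -
    have x: "x = (\<Sum>b\<in>UNIV. x $ b *\<^sub>R axis b 1)"
      using basis_expansion[of x] by (simp add: scalar_mult_eq_scaleR)
    have "N x \<le> (\<Sum>b\<in>UNIV. N (x $ b *\<^sub>R axis b 1))" by (subst x) (rule sum_le, simp)
    also have "\<dots> = (\<Sum>b\<in>UNIV. \<bar>x $ b\<bar> * N (axis b 1))" using N by (simp add: is_norm_def)
    also have "\<dots> \<le> (\<Sum>b\<in>UNIV. B * N (axis b 1))"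
      by (intro sum_mono mult_right_mono that is_norm_nonneg[OF N])
    finally show ?thesis by (simp add: c_def sum_distrib_left mult.commute)
  qed
  have "c \<ge> 0" unfolding c_def by (intro sum_nonneg is_norm_nonneg[OF N])
  \<comment> \<open>Adding 1 makes the constant positive, since \<open>c\<close> has only been shown
    to be nonnegative.\<close>
  have "N x \<le> (c + 1) * B" if "\<And>b. \<bar>x $ b\<bar> \<le> B" for x B
  proof -
    have "0 \<le> B" using that[of undefined] by simp
    then show ?thesis using le[OF that] by (simp add: algebra_simps)
  qed
  with \<open>c \<ge> 0\<close> show ?thesis by (intro that[of "c + 1"]) auto
qed

lemma is_norm_diff:
  assumes "is_norm N" shows "\<bar>N x - N y\<bar> \<le> N (x - y)"
proof -
  have "N ((x - y) + y) \<le> N (x - y) + N y" "N ((y - x) + x) \<le> N (y - x) + N x"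
    using assms unfolding is_norm_def by blast+
  moreover have "N (y - x) = N (x - y)" using is_norm_minus[OF assms, of "x - y"] by simp
  ultimately show ?thesis by simp
qed

lemma is_norm_continuous:
  fixes N :: "real^'n \<Rightarrow> real"
  assumes N: "is_norm N"
  shows "continuous_on UNIV N"
proof -
  obtain c where c: "c > 0" "\<And>x B. (\<And>b. \<bar>x $ b\<bar> \<le> B) \<Longrightarrow> N x \<le> c * B"
    using is_norm_component_upper[OF N] by blast
  have "c-lipschitz_on UNIV N"
  proof (rule lipschitz_onI)
    fix x y :: "real^'n"
    have "N (x - y) \<le> c * norm (x - y)" by (rule c(2)) (rule component_le_norm_cart)
    then show "dist (N x) (N y) \<le> c * dist x y"
      using is_norm_diff[OF N, of x y] by (simp add: dist_norm)
  qed (use c in simp)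
  then show ?thesis by (rule lipschitz_on_continuous_on)
qed

text \<open>The continuous function \<open>N\<close> attains a minimum on the compact unit sphere,
  positive since \<open>N\<close> vanishes only at 0; homogeneity extends the bound.\<close>

lemma is_norm_lower:
  fixes N :: "real^'n \<Rightarrow> real"
  assumes N: "is_norm N"
  obtains m where "m > 0" "\<And>x. m * norm x \<le> N x"
proof -
  have "\<exists>u\<in>sphere 0 1. \<forall>y\<in>sphere (0::real^'n) 1. N u \<le> N y"
  proof (rule continuous_attains_inf)
    show "sphere (0::real^'n) 1 \<noteq> {}" using norm_axis_1[of undefined] by (auto intro!: exI[of _ "axis undefined 1"] simp: sphere_def)
    show "continuous_on (sphere 0 1) N" using is_norm_continuous[OF N] by (rule continuous_on_subset) simp
  qed simp
  then obtain u :: "real^'n" where u: "norm u = 1" "\<And>y. norm y = 1 \<Longrightarrow> N u \<le> N y" by auto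
  have "N u \<noteq> 0" using N u(1) unfolding is_norm_def by (metis norm_zero zero_neq_one)
  then have pos: "N u > 0" using is_norm_nonneg[OF N, of u] by simp
  have "N u * norm x \<le> N x" for x
  proof (cases "x = 0")
    case False
    then have "N u \<le> N ((1 / norm x) *\<^sub>R x)" by (intro u(2)) simp
    also have "\<dots> = \<bar>1 / norm x\<bar> * N x" using N unfolding is_norm_def by blast
    also have "\<dots> = N x / norm x" using False by simp
    finally show ?thesis using False by (simp add: field_simps)
  qed (simp add: is_norm_zero[OF N])
  with pos show ?thesis by (rule that)
qed

section \<open>Diameters of dyadic cubes\<close>

lemma SUP_mult_left_real:
  fixes f :: "'b \<Rightarrow> real"
  assumes "c > 0" "S \<noteq> {}" "bdd_above (f ` S)"
  shows "(SUP x\<in>S. c * f x) = c * (SUP x\<in>S. f x)"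
proof (rule antisym)
  show "(SUP x\<in>S. c * f x) \<le> c * (SUP x\<in>S. f x)"
    using assms by (intro cSUP_least) (auto intro: cSUP_upper)
  obtain B where "\<And>x. x \<in> S \<Longrightarrow> f x \<le> B" using assms(3) by (auto simp: bdd_above_def)
  then have bdd: "bdd_above ((\<lambda>x. c * f x) ` S)" using assms(1) by (intro bdd_aboveI[of _ "c * B"]) auto
  have "(SUP x\<in>S. f x) \<le> (SUP x\<in>S. c * f x) / c"
    using assms by (intro cSUP_least) (auto simp: field_simps intro: cSUP_upper[OF _ bdd])
  then show "c * (SUP x\<in>S. f x) \<le> (SUP x\<in>S. c * f x)" using assms by (simp add: field_simps)
qed

lemma cell_image:
  fixes x :: "real^'n"
  shows "cell j x = (\<lambda>z. low_corner j x + (2 powr (- real_of_int j)) *\<^sub>R z) ` cell 0 0"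
proof -
  have *: "low_corner 0 (0::real^'n) = 0" by (simp add: low_corner_def vec_eq_iff)
  show ?thesis
  proof (intro set_eqI iffI)
    fix y assume "y \<in> cell j x"
    then have "(2 powr real_of_int j) *\<^sub>R (y - low_corner j x) \<in> cell 0 0"
      by (auto simp: cell_low_corner * powr_minus field_simps)
    moreover have "y = low_corner j x + (2 powr (- real_of_int j)) *\<^sub>R ((2 powr real_of_int j) *\<^sub>R (y - low_corner j x))"
      by (simp add: powr_add[symmetric])
    ultimately show "y \<in> (\<lambda>z. low_corner j x + (2 powr (- real_of_int j)) *\<^sub>R z) ` cell 0 0" by blast
  next
    fix y assume "y \<in> (\<lambda>z. low_corner j x + (2 powr (- real_of_int j)) *\<^sub>R z) ` cell 0 0"
    then show "y \<in> cell j x" by (auto simp: cell_low_corner *)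
  qed
qed

text \<open>A cube is a translate of a dilated unit cube and \<open>N\<close> is homogeneous, so
  \<open>c\<close> is the diameter of the unit cube. Sides can then replace diameters
  throughout.\<close>

lemma diamN_dyadic:
  fixes N :: "real^'n \<Rightarrow> real"
  assumes N: "is_norm N"
  obtains c where "c > 0" "\<And>Q. Q \<in> dyadic_cubes \<Longrightarrow> diamN N Q = c * side Q"
proof -
  define u :: "(real^'n) set" where "u = cell 0 0"
  have u: "u \<noteq> {}" unfolding u_def using mem_cell by blast
  obtain c where c: "c > 0" "\<And>x B. (\<And>b. \<bar>x $ b\<bar> \<le> B) \<Longrightarrow> N x \<le> c * B"
    using is_norm_component_upper[OF N] by blast
  have le: "N (x - y) \<le> c" if "x \<in> u" "y \<in> u" for x y
    using closure_dyadic_component[of u x y] that closure_subset[of u] c(2)[of "x - y" 1]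
    by (auto simp: u_def)
  have bdd1: "bdd_above ((\<lambda>y. N (x - y)) ` u)" if "x \<in> u" for x
    using le[OF that] by (intro bdd_aboveI[of _ c]) auto
  have le2: "(SUP y\<in>u. N (x - y)) \<le> c" if "x \<in> u" for x
    using le[OF that] u by (intro cSUP_least) auto
  then have bdd2: "bdd_above ((\<lambda>x. SUP y\<in>u. N (x - y)) ` u)"
    by (intro bdd_aboveI[of _ c]) auto
  have "diamN N (cell j x) = diamN N u * 2 powr (- real_of_int j)" for j and x :: "real^'n"
  proof -
    define e where "e = 2 powr (- real_of_int j)"
    have e: "e > 0" by (simp add: e_def)
    have scale: "N (e *\<^sub>R z) = e * N z" for z
      using N e unfolding is_norm_def by (metis abs_of_pos)
    have "diamN N (cell j x) = (SUP v\<in>u. SUP w\<in>u. N (e *\<^sub>R (v - w)))"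
      unfolding diamN_def cell_image[of j x] u_def[symmetric] e_def[symmetric]
      by (simp add: image_image scaleR_diff_right)
    also have "\<dots> = (SUP v\<in>u. e * (SUP w\<in>u. N (v - w)))"
      unfolding scale by (intro SUP_cong refl SUP_mult_left_real e u bdd1)
    also have "\<dots> = e * diamN N u"
      unfolding diamN_def by (intro SUP_mult_left_real e u bdd2)
    finally show ?thesis by (simp add: e_def)
  qed
  moreover have "diamN N u > 0"
  proof -
    define v :: "real^'n" where "v = (\<chi> b. 1/2)"
    have *: "low_corner 0 (0::real^'n) = 0" by (simp add: low_corner_def vec_eq_iff)
    have uv: "v \<in> u" "0 \<in> u" by (simp_all add: u_def cell_low_corner * v_def)
    have "v \<noteq> 0" by (simp add: v_def vec_eq_iff)
    then have "0 < N (v - 0)" using N is_norm_nonneg[OF N, of v] unfolding is_norm_def by (metis diff_zero order_le_less)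
    also have "\<dots> \<le> (SUP y\<in>u. N (v - y))" using uv bdd1 by (intro cSUP_upper) auto
    also have "\<dots> \<le> diamN N u" unfolding diamN_def using uv bdd2 by (intro cSUP_upper) auto
    finally show ?thesis .
  qed
  ultimately show ?thesis by (intro that[of "diamN N u"]) (auto elim!: dyadic_cubesE)
qed

subsection \<open>Good cubes inside the shrunken balls\<close>

text \<open>Scale \<open>j\<close> matches the radius \<open>r\<close>, scale \<open>j'\<close> the
  shrunken radius \<open>r powr t\<close>. Since \<open>s * t < d\<close>, \<open>r powr d\<close>
  is negligible against \<open>r powr (s * t)\<close> for small \<open>r\<close>, whatever the
  factor \<open>K\<close>.\<close>

lemma exists_scales:
  fixes c K s t d :: real
  assumes "0 < c" "0 < K" "0 < s" "1 < t" "s * t < d"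
  obtains \<rho> where "0 < \<rho>"
    "\<And>r. 0 < r \<Longrightarrow> r < \<rho> \<Longrightarrow> \<exists>j j'. j \<le> j' \<and> 2 powr (- real_of_int j) \<le> r \<and> r < 2 * 2 powr (- real_of_int j)
      \<and> c * 2 powr (- real_of_int j') < r powr t
      \<and> K * (2 powr (- real_of_int j)) powr d \<le> (2 powr (- real_of_int j')) powr s"
proof -
  \<comment> \<open>The value for which \<open>K * q * r powr (s * t)\<close> equals
    \<open>(r powr t / (4 * c)) powr s\<close>.\<close>
  define q where "q = 1 / (K * (4 * c) powr s)"
  have q: "q > 0" using assms by (simp add: q_def)
  \<comment> \<open>The first bound gives \<open>r powr (d - s * t) \<le> q\<close>; the second
    gives \<open>r powr (t - 1) \<le> c\<close> and hence \<open>j \<le> j'\<close>.\<close>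
  define \<rho> where "\<rho> = min (q powr (1 / (d - s * t))) (c powr (1 / (t - 1)))"
  show ?thesis
  proof (rule that[of \<rho>])
    show "0 < \<rho>" using q assms by (simp add: \<rho>_def)
    fix r :: real assume r: "0 < r" "r < \<rho>"
    have "r powr (d - s * t) \<le> (q powr (1 / (d - s * t))) powr (d - s * t)"
      using r assms by (intro powr_mono2) (auto simp: \<rho>_def)
    then have rq: "r powr (d - s * t) \<le> q" using assms q by (simp add: powr_powr)
    have "r powr (t - 1) \<le> (c powr (1 / (t - 1))) powr (t - 1)"
      using r assms by (intro powr_mono2) (auto simp: \<rho>_def)
    then have rc: "r powr (t - 1) \<le> c" using assms by (simp add: powr_powr)
    obtain j where j: "2 powr (- real_of_int j) \<le> r" "r < 2 * 2 powr (- real_of_int j)"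
      using r(1) by (rule dyadic_scale_exists)
    have "0 < r powr t / (2 * c)" using r assms by simp
    \<comment> \<open>The denominator \<open>2 * c\<close> leaves room for the strict bound by
      \<open>r powr t\<close>, and the side still exceeds \<open>r powr t / (4 * c)\<close>.\<close>
    then obtain j' where j': "2 powr (- real_of_int j') \<le> r powr t / (2 * c)"
      "r powr t / (2 * c) < 2 * 2 powr (- real_of_int j')"
      by (rule dyadic_scale_exists)
    have rt: "r powr t = r powr (t - 1) * r" using r by (simp add: powr_diff)
    have "r powr t / (2 * c) \<le> r / 2"
      using rc r assms by (simp add: rt field_simps)
    then have "2 powr (- real_of_int j') < 2 powr (- real_of_int j)" using j' j by linarith
    then have "j \<le> j'" by simp
    moreover have "c * 2 powr (- real_of_int j') < r powr t"
    proof -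
      have "c * 2 powr (- real_of_int j') \<le> c * (r powr t / (2 * c))"
        using j' assms by (intro mult_left_mono) auto
      also have "\<dots> = r powr t / 2" using assms by simp
      also have "\<dots> < r powr t" using r by simp
      finally show ?thesis .
    qed
    moreover have "K * (2 powr (- real_of_int j)) powr d \<le> (2 powr (- real_of_int j')) powr s"
    proof -
      have d: "0 < d" using assms by (smt (verit) mult_pos_pos)
      have "K * (2 powr (- real_of_int j)) powr d \<le> K * r powr d"
        using j assms d by (intro mult_left_mono powr_mono2) auto
      also have "r powr d = r powr (d - s * t) * r powr (s * t)"
        using r by (simp add: powr_add[symmetric])
      also have "K * (r powr (d - s * t) * r powr (s * t)) \<le> K * (q * r powr (s * t))"
        using rq assms by (intro mult_left_mono mult_right_mono) auto
      also have "\<dots> = (r powr t / (4 * c)) powr s"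
        using assms r by (simp add: q_def powr_divide powr_powr mult.commute)
      also have "\<dots> \<le> (2 powr (- real_of_int j')) powr s"
      proof (rule powr_mono2)
        show "r powr t / (4 * c) \<le> 2 powr (- real_of_int j')" using j'(2) assms by (simp add: field_simps)
      qed (use assms in auto)
      finally show ?thesis .
    qed
    ultimately show "\<exists>j j'. j \<le> j' \<and> 2 powr (- real_of_int j) \<le> r \<and> r < 2 * 2 powr (- real_of_int j)
      \<and> c * 2 powr (- real_of_int j') < r powr t
      \<and> K * (2 powr (- real_of_int j)) powr d \<le> (2 powr (- real_of_int j')) powr s"
      using j by blast
  qed
qed

text \<open>A comparison of volumes: \<open>A\<close> is the volume factor of the enlargement by
  \<open>2 / m\<close>. The hypothesis \<open>sparse\<close> and the choice of \<open>K\<close>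
  bound each of the two parts of \<open>R\<close> by
  \<open>\<sigma> powr (d - s) * w / (2 * A)\<close> at exponent \<open>d\<close>, where
  \<open>w < \<sigma> powr s\<close> is the cost of \<open>C\<close> inside
  \<open>L\<close>.\<close>

lemma good_cube_in_balls:
  fixes N :: "real^'n \<Rightarrow> real" and L :: "(real^'n) set"
  assumes N: "is_norm N" and L: "L \<in> dyadic_cubes" and C: "C \<subseteq> dyadic_cubes"
    and s: "0 < s" "1 < t" "s * t < real CARD('n)"
    and low: "m > 0" "\<And>x. m * norm x \<le> N x"
    and A: "A = (2 * (2 / m + 1)) ^ CARD('n)"
    and sparse: "\<And>Q. Q \<in> C \<Longrightarrow> Q \<subseteq> L \<Longrightarrow> side Q \<le> side L * (2 * A) powr (- 1 / (real CARD('n) - s))"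
    and L_good: "good s C L"
    and r: "\<And>i. i \<in> I \<Longrightarrow> 0 < r i"
    and cov: "AE x in lborel. x \<in> interior L \<longrightarrow> (\<forall>\<rho>>0. \<exists>i\<in>I. r i < \<rho> \<and> N (x - xs i) < r i)"
  shows "\<exists>i\<in>I. \<exists>P\<in>dyadic_cubes. P \<subseteq> L \<and> good s C P \<and> closure P \<subseteq> {y. N (y - xs i) < r i powr t}"
proof (rule ccontr)
  assume none: "\<not> ?thesis"
  define d where "d = real CARD('n)"
  have d: "0 < d" by (simp add: d_def)
  have sd: "s < d"
  proof -
    have "s \<le> s * t" using s by simp
    then show ?thesis using s(3) unfolding d_def by linarith
  qed
  have A0: "0 < A" unfolding A by (rule zero_less_power) (use low in \<open>simp add: add_pos_pos\<close>)
  define \<sigma> where "\<sigma> = side L"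
  have \<sigma>: "0 < \<sigma>" using L by (simp add: \<sigma>_def)
  \<comment> \<open>Chosen so that \<open>1 / K = \<sigma> powr (d - s) / (2 * A)\<close>, the same
    factor that \<open>sparse\<close> gives for the members of \<open>C\<close>.\<close>
  define K where "K = 2 * A * \<sigma> powr (s - d)"
  have K: "0 < K" using A0 \<sigma> by (simp add: K_def)
  obtain c where c: "c > 0" "\<And>x B. (\<And>b. \<bar>x $ b\<bar> \<le> B) \<Longrightarrow> N x \<le> c * B"
    using is_norm_component_upper[OF N] by blast
  obtain \<rho>0 where \<rho>0: "0 < \<rho>0"
    "\<And>r. 0 < r \<Longrightarrow> r < \<rho>0 \<Longrightarrow> \<exists>j j'. j \<le> j' \<and> 2 powr (- real_of_int j) \<le> r \<and> r < 2 * 2 powr (- real_of_int j)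
      \<and> c * 2 powr (- real_of_int j') < r powr t
      \<and> K * (2 powr (- real_of_int j)) powr d \<le> (2 powr (- real_of_int j')) powr s"
    by (rule exists_scales[OF c(1) K s(1,2)]) (use s(3) in \<open>auto simp: d_def\<close>)
  define B where "B = {P\<in>dyadic_cubes. P \<subseteq> L \<and> ennreal (K * side P powr d) \<le> cost s (C \<inter> Pow P)}"
  obtain M where M: "M \<subseteq> B" "pairwise disjnt M" "\<And>Q. Q \<in> B \<Longrightarrow> \<exists>P\<in>M. Q \<subseteq> P"
    by (rule dyadic_maximal[of B \<sigma>]) (use L in \<open>auto simp: B_def \<sigma>_def intro: side_mono\<close>)
  define CL where "CL = C \<inter> Pow L"
  define R where "R = CL \<union> M"
  have Md: "M \<subseteq> dyadic_cubes" using M(1) by (auto simp: B_def)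
  have Rd: "R \<subseteq> dyadic_cubes" using Md C by (auto simp: R_def CL_def)
  have near: "\<exists>Q\<in>R. \<exists>z\<in>Q. \<forall>b. \<bar>x $ b - z $ b\<bar> \<le> 2 / m * side Q"
    if x: "x \<in> interior L" and approx: "\<forall>\<rho>>0. \<exists>i\<in>I. r i < \<rho> \<and> N (x - xs i) < r i" for x
  proof -
    obtain e where e: "e > 0" "ball x e \<subseteq> L" using x by (auto simp: mem_interior)
    \<comment> \<open>The three bounds allow the choice of scales, put the centre
      \<open>xs i\<close> into \<open>L\<close>, and make the cube \<open>P\<close> around it small
      enough to lie in \<open>L\<close>.\<close>
    define \<rho> where "\<rho> = min \<rho>0 (min (m * e) \<sigma>)"
    have "\<rho> > 0" using \<rho>0 e low \<sigma> by (simp add: \<rho>_def)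
    with approx obtain i where i: "i \<in> I" "r i < \<rho>" "N (x - xs i) < r i" by auto
    then have ri: "r i < \<rho>0" "r i < m * e" "r i < \<sigma>" "0 < r i" using r by (auto simp: \<rho>_def)
    have dist: "norm (x - xs i) \<le> r i / m"
      using low(2)[of "x - xs i"] i(3) low(1) by (simp add: field_simps)
    also have "\<dots> < e" using ri(2) low(1) by (simp add: field_simps)
    finally have xiL: "xs i \<in> L" using e by (auto simp: dist_norm)
    obtain j j' where j: "j \<le> j'" "2 powr (- real_of_int j) \<le> r i" "r i < 2 * 2 powr (- real_of_int j)"
      "c * 2 powr (- real_of_int j') < r i powr t"
      "K * (2 powr (- real_of_int j)) powr d \<le> (2 powr (- real_of_int j')) powr s"
      using \<rho>0(2)[OF ri(4,1)] by blast
    define P where "P = cell j (xs i)"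
    define p where "p = cell j' (xs i)"
    have Pp: "P \<in> dyadic_cubes" "p \<in> dyadic_cubes" "xs i \<in> P" "xs i \<in> p" "p \<subseteq> P"
      using cell_mono[OF j(1)] by (simp_all add: P_def p_def)
    have PL: "P \<subseteq> L"
      using j(2) ri(3) by (intro dyadic_nested[OF Pp(1) L Pp(3) xiL]) (simp add: P_def \<sigma>_def)
    have "closure p \<subseteq> {y. N (y - xs i) < r i powr t}"
    proof safe
      fix y assume y: "y \<in> closure p"
      have "N (y - xs i) \<le> c * side p"
        using closure_dyadic_component[OF Pp(2) y] closure_subset[of p] Pp(4) by (intro c(2)) auto
      with j(4) show "N (y - xs i) < r i powr t" by (simp add: p_def)
    qed
    with none i(1) Pp(2,5) PL have "\<not> good s C p" by blast
    \<comment> \<open>These are the two ways of failing to be good; either way the larger cube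
      \<open>P\<close> lies in a member of \<open>R\<close>.\<close>
    then consider (big) Q where "Q \<in> C" "p \<subseteq> Q" | (dense) "ennreal (side p powr s) \<le> cost s (C \<inter> Pow p)"
      unfolding good_def by (meson linorder_not_le)
    then have "\<exists>Q\<in>R. P \<subseteq> Q"
    proof cases
      case (big Q)
      then have Q: "Q \<in> dyadic_cubes" "xs i \<in> Q" using C Pp(4) by auto
      show ?thesis
      proof (cases "P \<subseteq> Q")
        case True
        have "\<not> L \<subseteq> Q" using L_good big(1) by (simp add: good_def)
        then have "Q \<subseteq> L" using dyadic_cases[OF Q(1) L] Q(2) xiL by blast
        with True big(1) show ?thesis by (auto simp: R_def CL_def)
      next
        case False
        then have QP: "Q \<subseteq> P" using dyadic_cases[OF Q(1) Pp(1)] Q(2) Pp(3) by blast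
        \<comment> \<open>A member of \<open>C\<close> between \<open>p\<close> and \<open>P\<close>
          alone costs at least \<open>side p powr s\<close>, which already puts \<open>P\<close>
          into \<open>B\<close>.\<close>
        have "side p \<le> side Q" using Pp(2) Q(1) big(2) by (rule side_mono)
        then have "K * side P powr d \<le> side Q powr s"
          using j(5) s(1) powr_mono2[of s "side p" "side Q"] by (simp add: P_def p_def)
        then have "ennreal (K * side P powr d) \<le> ennreal (side Q powr s)" by (rule ennreal_leI)
        also have "\<dots> \<le> cost s (C \<inter> Pow P)" using big(1) QP by (intro wsum_ge_point) auto
        finally have "P \<in> B" using Pp(1) PL by (simp add: B_def)
        with M(3) show ?thesis by (auto simp: R_def)
      qed
    next
      case dense
      have "ennreal (K * side P powr d) \<le> ennreal (side p powr s)"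
        using j(5) by (intro ennreal_leI) (simp add: P_def p_def)
      also have "\<dots> \<le> cost s (C \<inter> Pow P)"
        by (rule order_trans[OF dense]) (use Pp(5) in \<open>auto intro!: wsum_mono_set\<close>)
      finally have "P \<in> B" using Pp(1) PL by (simp add: B_def)
      with M(3) show ?thesis by (auto simp: R_def)
    qed
    then obtain Q where Q: "Q \<in> R" "P \<subseteq> Q" by auto
    \<comment> \<open>The 2 comes from \<open>r i < 2 * side P\<close>, the \<open>1 / m\<close>
      from comparing \<open>N\<close> with the Euclidean norm.\<close>
    have "\<bar>x $ b - xs i $ b\<bar> \<le> 2 / m * side Q" for b
    proof -
      have "\<bar>x $ b - xs i $ b\<bar> \<le> norm (x - xs i)" using component_le_norm_cart[of "x - xs i" b] by simp
      also have "\<dots> \<le> r i / m" by (rule dist)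
      also have "\<dots> \<le> 2 * side P / m" using j(3) low(1) by (intro divide_right_mono) (auto simp: P_def)
      also have "\<dots> \<le> 2 * side Q / m"
        using low(1) side_mono[OF Pp(1) _ Q(2)] Q(1) Rd by (intro divide_right_mono) auto
      finally show ?thesis by simp
    qed
    with Q Pp(3) show ?thesis by blast
  qed
  have "ennreal (side L powr d) \<le> ennreal A * cost d R"
    unfolding A d_def
  proof (rule side_le_enlarged_cover[OF L Rd])
    show "0 \<le> 2 / m" using low by simp
    show "AE x in lborel. x \<in> interior L \<longrightarrow> (\<exists>Q\<in>R. \<exists>z\<in>Q. \<forall>b. \<bar>x $ b - z $ b\<bar> \<le> 2 / m * side Q)"
      using cov by eventually_elim (use near in blast)
  qed
  also have "cost d R \<le> cost d CL + cost d M" unfolding R_def by (rule wsum_Un_le)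
  finally have main: "ennreal (\<sigma> powr d) \<le> ennreal A * (cost d CL + cost d M)"
    by (simp add: \<sigma>_def mult_left_mono)
  have "cost s CL < ennreal (\<sigma> powr s)" using L_good by (simp add: good_def CL_def \<sigma>_def)
  then obtain w where w: "cost s CL = ennreal w" "0 \<le> w" "w < \<sigma> powr s"
    by (cases "cost s CL") (auto simp: ennreal_less_iff)
  have "cost d CL \<le> ennreal ((\<sigma> * (2 * A) powr (- 1 / (d - s))) powr (d - s)) * cost s CL"
    by (rule cost_powr_le) (use C sparse sd in \<open>auto simp: CL_def \<sigma>_def d_def\<close>)
  also have "(\<sigma> * (2 * A) powr (- 1 / (d - s))) powr (d - s) = \<sigma> powr (d - s) / (2 * A)"
    using sd A0 \<sigma> by (simp add: powr_mult powr_divide powr_powr powr_minus_divide)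
  finally have cCL: "cost d CL \<le> ennreal (\<sigma> powr (d - s) / (2 * A) * w)"
    using w A0 by (simp add: ennreal_mult[symmetric])
  have "cost d M \<le> ennreal (1 / K) * wsum (\<lambda>P. cost s (C \<inter> Pow P)) M"
  proof (rule wsum_le_cmult)
    fix P assume "P \<in> M"
    then have "ennreal (K * side P powr d) \<le> cost s (C \<inter> Pow P)" using M(1) by (auto simp: B_def)
    then have "ennreal (1 / K) * ennreal (K * side P powr d) \<le> ennreal (1 / K) * cost s (C \<inter> Pow P)"
      by (rule mult_left_mono) simp
    then show "ennreal (side P powr d) \<le> ennreal (1 / K) * cost s (C \<inter> Pow P)"
      using K by (simp add: ennreal_mult[symmetric])
  qed
  also have "wsum (\<lambda>P. cost s (C \<inter> Pow P)) M = cost s (\<Union>P\<in>M. C \<inter> Pow P)"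
  proof (rule wsum_UN_disjoint[symmetric])
    show "countable M" using Md countable_dyadic_cubes countable_subset by blast
    show "disjoint_family_on (\<lambda>P. C \<inter> Pow P) M"
      by (rule disjoint_family_subcubes[OF M(2) C])
  qed
  also have "\<dots> \<le> cost s CL" by (rule wsum_mono_set) (use M(1) in \<open>auto simp: B_def CL_def\<close>)
  finally have "cost d M \<le> ennreal (1 / K) * ennreal w" using w by (simp add: mult_left_mono)
  then have cM: "cost d M \<le> ennreal (\<sigma> powr (d - s) / (2 * A) * w)"
    using w K \<sigma> A0 by (simp add: K_def ennreal_mult[symmetric] powr_diff ac_simps)
  have "ennreal (\<sigma> powr d) \<le> ennreal A * (ennreal (\<sigma> powr (d - s) / (2 * A) * w) + ennreal (\<sigma> powr (d - s) / (2 * A) * w))"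
    by (rule order_trans[OF main]) (intro mult_left_mono add_mono cCL cM, simp)
  also have "\<dots> = ennreal (\<sigma> powr (d - s) * w)"
    using w A0 by (simp add: ennreal_mult[symmetric] ennreal_plus[symmetric] del: ennreal_plus)
  finally have "\<sigma> powr d \<le> \<sigma> powr (d - s) * w" using w by (simp add: ennreal_le_iff)
  also have "\<dots> < \<sigma> powr (d - s) * \<sigma> powr s" using w \<sigma> by simp
  finally show False by (simp add: powr_add[symmetric])
qed

text \<open>Since radii are bounded, balls containing \<open>x\<close> have centres in a bounded
  set, so only finitely many of them have radius above \<open>1 / m\<close>. Discarding these and
  \<open>J\<close> leaves arbitrarily small radii.\<close>

lemma hom_ubiquitous_AE:
  fixes N :: "real^'n \<Rightarrow> real"
  assumes N: "is_norm N" and hu: "hom_ubiquitous N I xs r U" and J: "finite J"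
  shows "AE x in lborel. x \<in> U \<longrightarrow> (\<forall>\<rho>>0. \<exists>i\<in>I - J. r i < \<rho> \<and> N (x - xs i) < r i)"
proof -
  have ap: "approx_system N I xs r" using hu by (simp add: hom_ubiquitous_def)
  then obtain b where b: "\<And>i. i \<in> I \<Longrightarrow> r i \<le> b" by (auto simp: approx_system_def bdd_above_def)
  have "\<exists>i\<in>I - J. r i < \<rho> \<and> N (x - xs i) < r i"
    if inf: "infinite {i\<in>I. N (x - xs i) < r i}" and \<rho>: "\<rho> > 0" for x \<rho>
  proof -
    obtain m :: nat where m: "real m > max (N x + b) (1 / \<rho>)" using reals_Archimedean2 by blast
    then have "m > 0" using \<rho> by (metis divide_pos_pos less_trans max_less_iff_conj of_nat_0_less_iff zero_less_one)
    with m \<rho> have mr: "1 / real m < \<rho>" by (simp add: field_simps)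
    have "finite {i\<in>I. N (xs i) < real m \<and> r i > 1 / real m}" using ap by (simp add: approx_system_def)
    with inf J have inf': "infinite ({i\<in>I. N (x - xs i) < r i} - (J \<union> {i\<in>I. N (xs i) < real m \<and> r i > 1 / real m}))"
      by (intro Diff_infinite_finite) auto
    obtain i where i: "i \<in> I" "N (x - xs i) < r i" "i \<notin> J" "\<not> (N (xs i) < real m \<and> r i > 1 / real m)"
      using infinite_imp_nonempty[OF inf'] by blast
    have "N (xs i) \<le> N x + N (x - xs i)" using is_norm_diff[OF N, of x "xs i"] by linarith
    then have "N (xs i) < real m" using i(2) b[OF i(1)] m by linarith
    with i mr show ?thesis by (intro bexI[of _ i]) auto
  qed
  moreover have "AE x in lborel. x \<in> U \<longrightarrow> infinite {i\<in>I. N (x - xs i) < r i}"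
    using hu by (simp add: hom_ubiquitous_def AE_completion_iff)
  ultimately show ?thesis by (elim eventually_mono) blast
qed

text \<open>A stopping cube \<open>L'\<close> for a modified weight supplies the sparsity that
  \<open>good_cube_in_balls\<close> needs. Excluding a finite \<open>J\<close> lets each application
  yield a new index.\<close>

lemma good_step:
  fixes N :: "real^'n \<Rightarrow> real" and L :: "(real^'n) set"
  assumes N: "is_norm N" and hu: "hom_ubiquitous N I xs r U" and J: "finite J"
    and s: "0 < s" "1 < t" "s * t < real CARD('n)"
    and C: "C \<subseteq> dyadic_cubes" and L: "L \<in> dyadic_cubes" "L \<subseteq> U" "good s C L" and \<delta>: "0 < \<delta>"
  shows "\<exists>i\<in>I - J. \<exists>P\<in>dyadic_cubes. good s C P \<and> closure P \<subseteq> interior L \<and> side P \<le> \<delta>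
    \<and> closure P \<subseteq> {y. N (y - xs i) < r i powr t}"
proof -
  obtain m where low: "m > 0" "\<And>x. m * norm x \<le> N x" using is_norm_lower[OF N] by blast
  define A where "A = (2 * (2 / m + 1)) ^ CARD('n)"
  have A0: "0 < A" unfolding A_def by (rule zero_less_power) (use low in \<open>simp add: add_pos_pos\<close>)
  have sd: "s < real CARD('n)"
  proof -
    have "s \<le> s * t" using s by simp
    then show ?thesis using s(3) by linarith
  qed
  \<comment> \<open>The reciprocal of the factor in \<open>sparse\<close>: a member of
    \<open>C\<close> in \<open>L'\<close> violates sparsity when its side exceeds
    \<open>side L' / \<kappa>\<close>.\<close>
  define \<kappa> where "\<kappa> = (2 * A) powr (1 / (real CARD('n) - s))"
  have \<kappa>: "0 < \<kappa>" using A0 by (simp add: \<kappa>_def)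
  have \<kappa>_inv: "(2 * A) powr (- 1 / (real CARD('n) - s)) = 1 / \<kappa>"
    by (simp add: \<kappa>_def powr_minus_divide)
  define \<sigma> where "\<sigma> = side L powr s"
  define CL where "CL = C \<inter> Pow L"
  have CLd: "CL \<subseteq> dyadic_cubes" using C by (auto simp: CL_def)
  have "cost s CL < ennreal \<sigma>" using L(3) by (simp add: good_def CL_def \<sigma>_def)
  then obtain w where w: "cost s CL = ennreal w" "0 \<le> w" "w < \<sigma>"
    by (cases "cost s CL") (auto simp: ennreal_less_iff)
  \<comment> \<open>The gap \<open>\<sigma> - w\<close> is the slack in the goodness of
    \<open>L\<close>; dividing it by \<open>\<kappa> powr s\<close> makes the extra weight fit
    within that slack.\<close>
  obtain \<delta>' where \<delta>': "\<delta>' > 0" "cost s {Q\<in>CL. side Q < \<delta>'} < ennreal ((\<sigma> - w) / \<kappa> powr s)"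
    by (rule wsum_tail_small[of "\<lambda>Q. ennreal (side Q powr s)" CL side "ennreal ((\<sigma> - w) / \<kappa> powr s)"])
      (use w CLd \<kappa> in auto)
  define T where "T = {Q\<in>CL. side Q < \<delta>'}"
  text \<open>The extra weight on \<^term>\<open>T\<close> makes a stopping cube contain no cube of \<^term>\<open>C\<close> whose side
    is comparable to its own.\<close>
  define h where "h Q = ennreal (side Q powr s) * indicator CL Q
      + ennreal (\<kappa> powr s) * (ennreal (side Q powr s) * indicator T Q)" for Q :: "(real^'n) set"
  have hsum: "wsum h X = cost s (X \<inter> CL) + ennreal (\<kappa> powr s) * cost s (X \<inter> T)" for X
    unfolding h_def wsum_add wsum_cmult wsum_restrict ..
  have "wsum h dyadic_cubes = cost s CL + ennreal (\<kappa> powr s) * cost s T"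
    unfolding hsum using CLd by (simp add: T_def Int_absorb1 subset_iff)
  also have "\<dots> < ennreal w + ennreal (\<kappa> powr s) * ennreal ((\<sigma> - w) / \<kappa> powr s)"
    using \<delta>'(2) \<kappa> unfolding w(1) T_def[symmetric]
    by (intro ennreal_add_left_cancel_less[THEN iffD2] conjI ennreal_mult_strict_left_mono) auto
  also have "\<dots> = ennreal \<sigma>"
    using w \<kappa> by (simp add: ennreal_mult[symmetric] ennreal_plus[symmetric] del: ennreal_plus)
  finally have total: "wsum h dyadic_cubes < ennreal \<sigma>" .
  \<comment> \<open>Halving \<open>\<delta>'\<close> makes every member of \<open>C\<close> inside
    \<open>L'\<close> satisfy the strict inequality defining \<open>T\<close>.\<close>
  obtain L' where L': "L' \<in> dyadic_cubes" "closure L' \<subseteq> interior L" "side L' \<le> min \<delta> (\<delta>' / 2)"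
    "\<And>Q. Q \<in> CL \<Longrightarrow> \<not> L' \<subseteq> Q" "wsum h (dyadic_cubes \<inter> Pow L') < ennreal (side L' powr s)"
  proof (rule stopping_cube[of "interior L" CL "min \<delta> (\<delta>' / 2)" s h])
    show "wsum h dyadic_cubes < cost s C'" if "C' \<subseteq> dyadic_cubes" "interior L \<subseteq> \<Union>C'" for C'
      using total interior_cost_ge[OF L(1) that s(1)] sd by (simp add: \<sigma>_def)
    show "ennreal (side Q powr s) \<le> h Q" if "Q \<in> CL" for Q using that by (simp add: h_def)
  qed (use CLd \<delta> \<delta>' in auto)
  have L'L: "L' \<subseteq> L" using L'(2) closure_subset interior_subset by blast
  have CC: "C \<inter> Pow L' = (dyadic_cubes \<inter> Pow L') \<inter> CL" using C L'L by (auto simp: CL_def)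
  have L'_good: "good s C L'"
    unfolding good_def
  proof (intro conjI ballI notI)
    fix Q assume Q: "Q \<in> C" "L' \<subseteq> Q"
    then have "Q \<inter> L \<noteq> {}" using dyadic_nonempty[OF L'(1)] L'L by blast
    then have "Q \<subseteq> L" using dyadic_cases[of Q L] Q C L by (auto simp: good_def)
    then show False using L'(4)[of Q] Q by (simp add: CL_def)
  next
    have "cost s (C \<inter> Pow L') \<le> wsum h (dyadic_cubes \<inter> Pow L')" unfolding hsum CC by simp
    with L'(5) show "cost s (C \<inter> Pow L') < ennreal (side L' powr s)" by simp
  qed
  have sparse: "side Q \<le> side L' * (2 * A) powr (- 1 / (real CARD('n) - s))" if Q: "Q \<in> C" "Q \<subseteq> L'" for Q
  proof (rule ccontr)
    assume "\<not> ?thesis"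
    \<comment> \<open>Such a \<open>Q\<close> belongs to \<open>T\<close>, and its extra weight
      alone reaches \<open>side L' powr s\<close>, against the choice of \<open>L'\<close>.\<close>
    then have "side L' < \<kappa> * side Q" using \<kappa> unfolding \<kappa>_inv by (simp add: field_simps)
    then have "side L' powr s \<le> (\<kappa> * side Q) powr s"
      using s side_pos[OF L'(1)] by (intro powr_mono2) auto
    also have "\<dots> = \<kappa> powr s * side Q powr s" using \<kappa> Q C by (simp add: powr_mult)
    finally have "ennreal (side L' powr s) \<le> ennreal (\<kappa> powr s) * ennreal (side Q powr s)"
      by (simp add: ennreal_mult[symmetric] ennreal_leI)
    also have "\<dots> \<le> h Q"
    proof -
      have "side Q \<le> side L'" using Q C L'(1) by (auto intro: side_mono)
      then have "Q \<in> T" using Q L'L L'(3) \<delta>'(1) by (auto simp: T_def CL_def)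
      then show ?thesis by (simp add: h_def)
    qed
    also have "\<dots> \<le> wsum h (dyadic_cubes \<inter> Pow L')" using Q C by (intro wsum_ge_point) auto
    finally show False using L'(5) by simp
  qed
  have "\<exists>i\<in>I - J. \<exists>P\<in>dyadic_cubes. P \<subseteq> L' \<and> good s C P \<and> closure P \<subseteq> {y. N (y - xs i) < r i powr t}"
  proof (rule good_cube_in_balls[OF N L'(1) C s low A_def sparse L'_good])
    show "0 < r i" if "i \<in> I - J" for i using that hu by (auto simp: hom_ubiquitous_def approx_system_def)
    show "AE x in lborel. x \<in> interior L' \<longrightarrow> (\<forall>\<rho>>0. \<exists>i\<in>I - J. r i < \<rho> \<and> N (x - xs i) < r i)"
      using hom_ubiquitous_AE[OF N hu J]
      by eventually_elim (use L'L L(2) interior_subset in blast)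
  qed
  then obtain i P where P: "i \<in> I - J" "P \<in> dyadic_cubes" "P \<subseteq> L'" "good s C P"
    "closure P \<subseteq> {y. N (y - xs i) < r i powr t}" by blast
  moreover have "closure P \<subseteq> interior L" using closure_mono[OF P(3)] L'(2) by blast
  moreover have "side P \<le> \<delta>" using side_mono[OF P(2) L'(1) P(3)] L'(3) by simp
  ultimately show ?thesis by blast
qed

text \<open>If every cover of \<open>V\<close> cost more, \<open>stopping_cube\<close> would start a
  nested sequence of good cubes that \<open>good_step\<close> continues; their common point lies in
  the limsup set and in no member of \<open>C\<close>.\<close>

lemma cost_cover_ge:
  fixes N :: "real^'n \<Rightarrow> real"
  assumes N: "is_norm N" and I: "countable I" and hu: "hom_ubiquitous N I xs r U"
    and s: "0 < s" "1 < t" "s * t < real CARD('n)"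
    and V: "open V" "V \<subseteq> U"
    and C: "C \<subseteq> dyadic_cubes" "{x. infinite {i\<in>I. N (x - xs i) < r i powr t}} \<inter> V \<subseteq> \<Union>C"
  shows "\<exists>C'\<subseteq>dyadic_cubes. V \<subseteq> \<Union>C' \<and> cost s C' \<le> cost s C"
proof (rule ccontr)
  assume no: "\<not> ?thesis"
  \<comment> \<open>The indicator turns the total weight over all dyadic cubes into the cost of
    \<open>C\<close>.\<close>
  define h where "h Q = ennreal (side Q powr s) * indicator C Q" for Q :: "(real^'n) set"
  have hsum: "wsum h X = cost s (X \<inter> C)" for X unfolding h_def wsum_restrict ..
  obtain L0 where L0: "L0 \<in> dyadic_cubes" "closure L0 \<subseteq> V" "\<And>Q. Q \<in> C \<Longrightarrow> \<not> L0 \<subseteq> Q"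
    "wsum h (dyadic_cubes \<inter> Pow L0) < ennreal (side L0 powr s)"
  proof (rule stopping_cube[of V C 1 s h])
    have CC: "dyadic_cubes \<inter> C = C" using C by auto
    show "wsum h dyadic_cubes < cost s C'" if "C' \<subseteq> dyadic_cubes" "V \<subseteq> \<Union>C'" for C'
      using no that unfolding hsum CC by (meson linorder_not_le)
    show "ennreal (side Q powr s) \<le> h Q" if "Q \<in> C" for Q using that by (simp add: h_def)
  qed (use V C in auto)
  have "dyadic_cubes \<inter> Pow L0 \<inter> C = C \<inter> Pow L0" using C by auto
  with L0 have "good s C L0" by (simp add: good_def hsum)
  \<comment> \<open>Avoiding the indices numbered below \<open>n\<close> at stage \<open>n\<close>
    forces infinitely many distinct balls.\<close>
  define J where "J n = I \<inter> {i. to_nat_on I i < n}" for n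
  have J: "finite (J n)" for n
  proof (rule finite_imageD)
    show "finite (to_nat_on I ` J n)" by (rule finite_subset[of _ "{..<n}"]) (auto simp: J_def)
    show "inj_on (to_nat_on I) (J n)"
      using inj_on_to_nat_on[OF I] by (rule inj_on_subset) (auto simp: J_def)
  qed
  define good_in where "good_in n L \<longleftrightarrow> L \<in> dyadic_cubes \<and> L \<subseteq> V \<and> good s C L" for n :: nat and L
  define next_cube where "next_cube n L P \<longleftrightarrow> closure P \<subseteq> interior L \<and> side P \<le> 1 / real (Suc n)
    \<and> (\<exists>i\<in>I - J n. closure P \<subseteq> {y. N (y - xs i) < r i powr t})" for n L P
  obtain f where f: "\<And>n. good_in n (f n)" "\<And>n. next_cube n (f n) (f (Suc n))"
  proof -
    have "\<exists>f. \<forall>n. good_in n (f n) \<and> next_cube n (f n) (f (Suc n))"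
    proof (rule dependent_nat_choice)
      show "\<exists>L. good_in 0 L" using L0 \<open>good s C L0\<close> closure_subset unfolding good_in_def by blast
      fix L n assume L: "good_in n L"
      obtain i P where P: "i \<in> I - J n" "P \<in> dyadic_cubes" "good s C P" "closure P \<subseteq> interior L"
        "side P \<le> 1 / real (Suc n)" "closure P \<subseteq> {y. N (y - xs i) < r i powr t}"
        using good_step[OF N hu J[of n] s C(1), of L "1 / real (Suc n)"] L V by (auto simp: good_in_def)
      then have "P \<subseteq> V" using L closure_subset interior_subset unfolding good_in_def by blast
      with P show "\<exists>P. good_in (Suc n) P \<and> next_cube n L P"
        unfolding good_in_def next_cube_def by blast
    qed
    then show ?thesis using that by blast
  qed
  have fd: "f n \<in> dyadic_cubes" for n using f(1) by (simp add: good_in_def)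
  \<comment> \<open>Each closure lies in the preceding cube, so the limit point belongs to the
    half-open cubes themselves.\<close>
  have step: "closure (f (Suc n)) \<subseteq> f n" for n
    using f(2)[of n] interior_subset unfolding next_cube_def by blast
  have "\<exists>x. \<forall>n. x \<in> closure (f n)"
  proof -
    have "bounded (closure (f 0))"
    proof (rule bounded_closure)
      obtain j x where "f 0 = cell j x" using fd[of 0] by (rule dyadic_cubesE)
      then show "bounded (f 0)" using bounded_subset[OF bounded_cbox cell_subset_cbox] by metis
    qed
    then have "(\<Inter>n. closure (f n)) \<noteq> {}"
    proof (intro compact_nest)
      show "compact (closure (f n))" for n
      proof -
        obtain j x where "f n = cell j x" using fd[of n] by (rule dyadic_cubesE)
        then have "bounded (f n)" using bounded_subset[OF bounded_cbox cell_subset_cbox] by metis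
        then show ?thesis by (simp add: compact_closure)
      qed
      show "closure (f n) \<noteq> {}" for n using dyadic_nonempty[OF fd] by simp
      show "closure (f n) \<subseteq> closure (f m)" if "m \<le> n" for m n
        using that
      proof (induction rule: dec_induct)
        case (step n)
        then show ?case using closure_subset \<open>\<And>n. closure (f (Suc n)) \<subseteq> f n\<close> by blast
      qed simp
    qed
    then show ?thesis by auto
  qed
  then obtain x where x: "\<And>n. x \<in> closure (f n)" by blast
  have xf: "x \<in> f n" for n using x[of "Suc n"] step by blast
  have "infinite {i\<in>I. N (x - xs i) < r i powr t}"
  proof
    assume fin: "finite {i\<in>I. N (x - xs i) < r i powr t}"
    obtain n where "to_nat_on I ` {i\<in>I. N (x - xs i) < r i powr t} \<subseteq> {..<n}"
      using finite_nat_bounded[OF finite_imageI[OF fin, of "to_nat_on I"]] by blast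
    then have n: "to_nat_on I i < n" if "i \<in> I" "N (x - xs i) < r i powr t" for i
      using that by blast
    obtain i where "i \<in> I - J n" "N (x - xs i) < r i powr t"
      using f(2)[of n] x[of "Suc n"] unfolding next_cube_def by blast
    with n show False by (auto simp: J_def)
  qed
  moreover have "x \<in> V" using xf[of 0] f(1)[of 0] by (auto simp: good_in_def)
  ultimately obtain Q where Q: "Q \<in> C" "x \<in> Q" using C(2) by blast
  then have Qd: "Q \<in> dyadic_cubes" using C by auto
  \<comment> \<open>Nestedness puts \<open>Q\<close> inside every \<open>f (Suc n)\<close>; their
    sides tend to 0, while that of \<open>Q\<close> is positive.\<close>
  have "side Q \<le> 1 / real (Suc n)" for n
  proof -
    have "\<not> f (Suc n) \<subseteq> Q" using f(1)[of "Suc n"] Q(1) by (simp add: good_in_def good_def)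
    then have "Q \<subseteq> f (Suc n)" using dyadic_cases[OF Qd fd] Q(2) xf by blast
    then have "side Q \<le> side (f (Suc n))" by (rule side_mono[OF Qd fd])
    with f(2)[of n] show ?thesis by (simp add: next_cube_def)
  qed
  with side_pos[OF Qd] show False by (meson nat_approx_posE linorder_not_le)
qed

section \<open>The limsup set as a countable intersection of open sets, and the conclusion\<close>

lemma gdelta_infinitely_often:
  fixes B :: "'i \<Rightarrow> 'a::topological_space set"
  assumes I: "countable I" and op: "\<And>i. i \<in> I \<Longrightarrow> open (B i)"
  shows "gdelta_in euclidean {x. infinite {i\<in>I. x \<in> B i}}"
proof -
  \<comment> \<open>A set of indices is infinite iff it contains indices with arbitrarily large
    number in an enumeration of \<open>I\<close>.\<close>
  have "{x. infinite {i\<in>I. x \<in> B i}} = (\<Inter>n. \<Union>i\<in>{i\<in>I. n \<le> to_nat_on I i}. B i)"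
  proof (intro set_eqI iffI)
    fix x assume x: "x \<in> {x. infinite {i\<in>I. x \<in> B i}}"
    have inj: "inj_on (to_nat_on I) {i\<in>I. x \<in> B i}"
      using inj_on_to_nat_on[OF I] by (rule inj_on_subset) auto
    have "infinite (to_nat_on I ` {i\<in>I. x \<in> B i})" using x finite_imageD[OF _ inj] by blast
    then have "\<exists>k\<ge>n. k \<in> to_nat_on I ` {i\<in>I. x \<in> B i}" for n
      by (simp add: infinite_nat_iff_unbounded_le)
    then show "x \<in> (\<Inter>n. \<Union>i\<in>{i\<in>I. n \<le> to_nat_on I i}. B i)" by fastforce
  next
    fix x assume x: "x \<in> (\<Inter>n. \<Union>i\<in>{i\<in>I. n \<le> to_nat_on I i}. B i)"
    have "\<exists>k\<ge>n. k \<in> to_nat_on I ` {i\<in>I. x \<in> B i}" for n using x by fastforce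
    then have "infinite (to_nat_on I ` {i\<in>I. x \<in> B i})" by (simp add: infinite_nat_iff_unbounded_le)
    then show "x \<in> {x. infinite {i\<in>I. x \<in> B i}}" using finite_imageI by blast
  qed
  also have "gdelta_in euclidean \<dots>"
    by (intro gdelta_in_Inter) (auto intro!: open_imp_gdelta_in open_UN op)
  finally show ?thesis .
qed

theorem theorem5p9:
  fixes N :: "real^'n \<Rightarrow> real" and I :: "'i set"
    and xs :: "'i \<Rightarrow> real^'n" and r :: "'i \<Rightarrow> real" and U :: "(real^'n) set"
  assumes "is_norm N"
    and "countable I" and "infinite I"
    and "open U" and "U \<noteq> {}"
    and "hom_ubiquitous N I xs r U"
    and "t > 1"
  shows "{x. infinite {i\<in>I. N (x - xs i) < r i powr t}}
           \<in> large_int_class N (real CARD('n) / t) U"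
  unfolding large_int_class_def
proof (intro CollectI conjI allI impI)
  have "open {x. N (x - xs i) < r i powr t}" for i
    by (intro open_Collect_less continuous_on_compose2[OF is_norm_continuous[OF assms(1)]] continuous_intros) auto
  then show "gdelta_in euclidean {x. infinite {i\<in>I. N (x - xs i) < r i powr t}}"
    using gdelta_infinitely_often[OF assms(2), of "\<lambda>i. {x. N (x - xs i) < r i powr t}"] by simp
next
  fix s V assume "0 < s \<and> s < real CARD('n) / t \<and> open V \<and> V \<subseteq> U"
  then have s: "0 < s" "s * t < real CARD('n)" and V: "open V" "V \<subseteq> U"
    using assms(7) by (auto simp: field_simps)
  let ?F = "{x. infinite {i\<in>I. N (x - xs i) < r i powr t}}"
  obtain c where c: "c > 0" "\<And>Q. Q \<in> dyadic_cubes \<Longrightarrow> diamN N Q = c * side Q"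
    using diamN_dyadic[OF assms(1)] by blast
  \<comment> \<open>Diameters are proportional to sides, so both contents carry the same factor
    \<open>c powr s\<close> and comparing costs is enough.\<close>
  have sum: "infsum (\<lambda>Q. ennreal (diamN N Q powr s)) C = ennreal (c powr s) * cost s C"
    if "C \<subseteq> dyadic_cubes" for C
  proof -
    have "infsum (\<lambda>Q. ennreal (diamN N Q powr s)) C = infsum (\<lambda>Q. ennreal (c powr s) * ennreal (side Q powr s)) C"
    proof (rule infsum_cong)
      fix Q assume "Q \<in> C"
      with that have Q: "Q \<in> dyadic_cubes" by blast
      then show "ennreal (diamN N Q powr s) = ennreal (c powr s) * ennreal (side Q powr s)"
        using c side_pos[OF Q] by (simp add: powr_mult ennreal_mult[symmetric])
    qed
    also have "\<dots> = wsum (\<lambda>Q. ennreal (c powr s) * ennreal (side Q powr s)) C"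
      by (rule infsum_eq_wsum) (use that countable_dyadic_cubes countable_subset in blast)
    finally show ?thesis by (simp add: wsum_cmult)
  qed
  show "net_content N s (?F \<inter> V) = net_content N s V"
  proof (rule antisym)
    show "net_content N s (?F \<inter> V) \<le> net_content N s V"
      unfolding net_content_def by (rule Inf_superset_mono) blast
    show "net_content N s V \<le> net_content N s (?F \<inter> V)"
      unfolding net_content_def[of _ _ "?F \<inter> V"]
    proof (rule Inf_greatest, clarify)
      fix C :: "(real^'n) set set" assume C: "countable C" "C \<subseteq> dyadic_cubes" "?F \<inter> V \<subseteq> \<Union>C"
      obtain C' where C': "C' \<subseteq> dyadic_cubes" "V \<subseteq> \<Union>C'" "cost s C' \<le> cost s C"
        using cost_cover_ge[OF assms(1,2,6) s(1) assms(7) s(2) V C(2,3)] by blast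
      have "net_content N s V \<le> infsum (\<lambda>Q. ennreal (diamN N Q powr s)) C'"
        unfolding net_content_def
      proof (rule Inf_lower)
        have "countable C'" using C'(1) countable_dyadic_cubes countable_subset by blast
        with C' show "infsum (\<lambda>Q. ennreal (diamN N Q powr s)) C' \<in>
          {infsum (\<lambda>Q. ennreal (diamN N Q powr s)) C |C. countable C \<and> C \<subseteq> dyadic_cubes \<and> V \<subseteq> \<Union> C}"
          by blast
      qed
      also have "\<dots> \<le> infsum (\<lambda>Q. ennreal (diamN N Q powr s)) C"
        unfolding sum[OF C'(1)] sum[OF C(2)] using C'(3) by (rule mult_left_mono) simp
      finally show "net_content N s V \<le> infsum (\<lambda>Q. ennreal (diamN N Q powr s)) C" .
    qed
  qed
qed

end
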